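(* There is an absolute constant $\delta_0>0$ (for example, $\delta_0=\frac1{20}$ works) such that the following holds. Let $\Omega:\mathbb{S}\to\mathbb{S}$ be an odd, twice continuously differentiable map which is bi-Lipschitz with constant $1+\delta_\Omega$ with respect to the geodesic distance on $\mathbb{S}$, where $0\le\delta_\Omega\le\delta_0$, and let $K(x)=|x|\,\Omega\left(\frac{x}{|x|}\right)$ for $x\in\mathbb{C}\setminus\{0\}$. Let $\mu$ be a (nonzero) Ahlfors $1$-regular, $\Omega$-symmetric measure in $\mathbb{C}$. Then there exist a constant $c>0$ and an affine line $L\subset\mathbb{C}$ such that $\mu=c\,\mathcal{H}^1|_{L}$.
   Context: $\mathbb{S}$ is the unit circle in $\mathbb{C}\cong\mathbb{R}^2$, with geodesic distance $d_{\mathbb{S}}$. $\Omega$ is odd if $\Omega(-\theta)=-\Omega(\theta)$. $\Omega$ is bi-Lipschitz with constant $1+\delta_\Omega$ if $(1+\delta_\Omega)^{-1}d_{\mathbb{S}}(\theta,\theta')\le d_{\mathbb{S}}(\Omega(\theta),\Omega(\theta'))\le(1+\delta_\Omega)d_{\mathbb{S}}(\theta,\theta')$ for all $\theta,\theta'\in\mathbb{S}$. $B(x,r)=\{y:|x-y|<r\}$; $K(0)$ is understood to be $0$. Measures are locally finite Borel measures on $\mathbb{C}$, and $\mathrm{spt}(\mu)$ denotes the support of $\mu$. $\mu$ is Ahlfors $1$-regular with constant $C_0>0$ if $C_0^{-1}r\le\mu(B(x,r))\le C_0r$ for all $x\in\mathrm{spt}(\mu)$ and all $r>0$; it is Ahlfors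 $1$-regular if this holds for some $C_0$. $\mu$ is $\Omega$-symmetric if $\int_{B(x,r)}K(x-y)\,d\mu(y)=0$ for all $x\in\mathrm{spt}(\mu)$ and all $r>0$. $\mathcal{H}^1$ is the $1$-dimensional Hausdorff measure, and $\mathcal{H}^1|_L$ its restriction to $L$. *)

theory Defs
  imports "HOL-Analysis.Analysis"
begin

abbreviation unit_circle :: "complex set" where
  "unit_circle \<equiv> sphere 0 1"

text \<open>The length of the shorter arc of the unit circle joining two of its points: for
  \<open>u = cis s\<close> and \<open>v = cis t\<close>, \<open>Arg (v / u)\<close> is the representative of \<open>t - s\<close> modulo
  \<open>2 * pi\<close> in the interval \<open>(- pi, pi]\<close>.\<close>

definition circle_dist :: "complex \<Rightarrow> complex \<Rightarrow> real" where
  "circle_dist u v = \<bar>Arg (v / u)\<bar>"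

text \<open>Self-maps of the circle are represented by functions on the whole plane, whose values off
  the circle are irrelevant.\<close>

definition odd_on_circle :: "(complex \<Rightarrow> complex) \<Rightarrow> bool" where
  "odd_on_circle \<Omega> \<longleftrightarrow> (\<forall>u\<in>unit_circle. \<Omega> (- u) = - \<Omega> u)"

definition bilipschitz_on_circle :: "real \<Rightarrow> (complex \<Rightarrow> complex) \<Rightarrow> bool" where
  "bilipschitz_on_circle C \<Omega> \<longleftrightarrow>
     (\<forall>u\<in>unit_circle. \<forall>v\<in>unit_circle.
        inverse C * circle_dist u v \<le> circle_dist (\<Omega> u) (\<Omega> v) \<and>
        circle_dist (\<Omega> u) (\<Omega> v) \<le> C * circle_dist u v)"

text \<open>Smoothness on the circle is tested in the arc-length coordinate \<open>t \<mapsto> cis t\<close>, which is a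
  local diffeomorphism from the line onto the circle.\<close>

definition C2_on_circle :: "(complex \<Rightarrow> complex) \<Rightarrow> bool" where
  "C2_on_circle \<Omega> \<longleftrightarrow>
     (\<exists>D. (\<forall>t. ((\<lambda>s. \<Omega> (cis s)) has_vector_derivative D t) (at t)) \<and> D C1_differentiable_on UNIV)"

definition kernel :: "(complex \<Rightarrow> complex) \<Rightarrow> complex \<Rightarrow> complex" where
  "kernel \<Omega> x = (if x = 0 then 0 else of_real (cmod x) * \<Omega> (x / of_real (cmod x)))"

definition locally_finite_borel :: "'a::topological_space measure \<Rightarrow> bool" where
  "locally_finite_borel \<mu> \<longleftrightarrow>
     sets \<mu> = sets borel \<and> (\<forall>x. \<exists>U. open U \<and> x \<in> U \<and> emeasure \<mu> U < \<infinity>)"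

definition spt :: "'a::topological_space measure \<Rightarrow> 'a set" where
  "spt \<mu> = {x. \<forall>U. open U \<and> x \<in> U \<longrightarrow> emeasure \<mu> U > 0}"

definition ahlfors_1_regular_with :: "real \<Rightarrow> 'a::metric_space measure \<Rightarrow> bool" where
  "ahlfors_1_regular_with C \<mu> \<longleftrightarrow>
     (\<forall>x\<in>spt \<mu>. \<forall>r>0. ennreal (inverse C * r) \<le> emeasure \<mu> (ball x r) \<and>
                       emeasure \<mu> (ball x r) \<le> ennreal (C * r))"

definition ahlfors_1_regular :: "'a::metric_space measure \<Rightarrow> bool" where
  "ahlfors_1_regular \<mu> \<longleftrightarrow> (\<exists>C>0. ahlfors_1_regular_with C \<mu>)"

text \<open>For a locally finite \<open>\<mu>\<close> and \<open>\<Omega>\<close> continuous on the circle, the integrand is continuous and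
  bounded on the ball, so the integral exists and the convention that non-integrable functions
  have integral \<open>0\<close> plays no role.\<close>

definition symmetric_measure :: "(complex \<Rightarrow> complex) \<Rightarrow> complex measure \<Rightarrow> bool" where
  "symmetric_measure \<Omega> \<mu> \<longleftrightarrow>
     (\<forall>x\<in>spt \<mu>. \<forall>r>0. (LINT y:ball x r|\<mu>. kernel \<Omega> (x - y)) = 0)"

text \<open>One-dimensional Hausdorff (outer) measure, normalised without a factor, so that it agrees
  with length on lines. Boundedness is required of the covering sets because the library's real-valued
  \<^const>\<open>diameter\<close> is unspecified on unbounded sets; finite covers are padded with the empty
  set, whose diameter is \<open>0\<close>.\<close>

definition hausdorff1_pre :: "real \<Rightarrow> 'a::metric_space set \<Rightarrow> ennreal" where
  "hausdorff1_pre \<epsilon> A =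
     (INF U \<in> {U :: nat \<Rightarrow> 'a set. A \<subseteq> (\<Union>i. U i) \<and> (\<forall>i. bounded (U i) \<and> diameter (U i) \<le> \<epsilon>)}.
        \<Sum>i. ennreal (diameter (U i)))"

definition hausdorff1 :: "'a::metric_space set \<Rightarrow> ennreal" where
  "hausdorff1 A = (SUP \<epsilon>\<in>{0<..}. hausdorff1_pre \<epsilon> A)"

end

theory Submission
  imports Defs
begin

text \<open>Write \<open>\<Omega>\<close> also for the degree-zero kernel \<open>z \<mapsto> \<Omega> (z / |z|)\<close>. Since
\<open>K (x - y) = |x - y| \<Omega> (x - y)\<close>, symmetry on all balls centred at \<open>x \<in> spt \<mu>\<close> says that the
positive and the negative part of each component of \<open>K (x - \<cdot>) \<mu>\<close> have the same distribution
of distances to \<open>x\<close> (\<open>radial_balance\<close>). Any radial weight may therefore be inserted, and with the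
weight \<open>\<psi> (r) / r\<close>, where \<open>\<psi> (r) = max 0 (1 - r / L)\<close>, one gets
\<open>\<integral> \<psi> (|x - y|) \<Omega> (x - y) d\<mu>(y) = 0\<close> for every \<open>x\<close> in the support.

For \<open>\<Omega> = id\<close> this integral is, up to the truncation, the gradient at \<open>x\<close> of the convex
function \<open>\<integral> |x - y| d\<mu>(y)\<close>, and the gradient of a convex function is monotone. This monotonicity
survives for general \<open>\<Omega>\<close>: an odd bi-Lipschitz circle map lifts, up to a reflection, to an
increasing function of the angle that commutes with half turns (\<open>circle_angle_lift\<close>). Passing from
\<open>p - y\<close> to \<open>x - y = (p - y) + (x - p)\<close> turns the direction towards that of \<open>x - p\<close>, so the image
direction turns towards \<open>\<Omega> (x - p)\<close>, and
\<open>G (y) = Re ((\<Omega> (x - y) - \<Omega> (p - y)) cnj (\<Omega> (x - p)))\<close> is nonnegative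
(\<open>monotone_gap_nonneg\<close>). For \<open>x, p \<in> spt \<mu>\<close> the tent \<open>\<psi>\<close> is \<open>1/L\<close>-Lipschitz, and
subtracting the two vanishing integrals shows that \<open>\<integral> G d\<mu>\<close> over \<open>ball p (L / 2)\<close> is at most
\<open>4 C |x - p|\<close>, uniformly in \<open>L\<close> (\<open>monotone_gap_integral_bound\<close>).

On the other hand \<open>G (y) \<ge> c / |p - y|\<close> for distant \<open>y\<close> in directions transversal to \<open>x - p\<close>
(\<open>monotone_gap_far\<close>). If three points \<open>p, x1, x2\<close> of the support were not collinear, every
direction would be transversal to \<open>x1 - p\<close> or to \<open>x2 - p\<close>, so the sum of the two gaps would
dominate \<open>c / |p - y|\<close>; but \<open>\<integral> d\<mu>(y) / |p - y|\<close> diverges logarithmically for a 1-regular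
measure. Hence the support lies on a line (\<open>spt_collinear\<close>).

On a line \<open>K\<close> is the identity up to a constant factor of modulus one, and inserting the radial
weight \<open>1 / r\<close> shows that \<open>\<mu>\<close> is invariant under reflection in each point of its support. There
are no atoms, so the support has no isolated points, and composing reflections in nearby points
gives arbitrarily small periods; this forces a multiple of Lebesgue measure
(\<open>small_periods_imp_lborel_multiple\<close>), which on a line is \<open>\<H>\<^sup>1\<close>
(\<open>hausdorff1_isometric_image\<close>).\<close>

section \<open>Lifting the circle map to an increasing function of the angle\<close>

lemma circle_dist_cis:
  assumes "\<bar>t - s\<bar> \<le> pi"
  shows "circle_dist (cis s) (cis t) = \<bar>t - s\<bar>"
proof (cases "t - s = - pi")
  case True
  have "cis t / cis s = cis (t - s)" by (simp add: cis_divide)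
  also have "\<dots> = -1" using True by (simp add: complex_eq_iff)
  finally show ?thesis using True by (simp add: circle_dist_def Arg_eq_pi[THEN iffD2])
next
  case False
  then have "Arg (cis (t - s)) = t - s"
    using assms by (intro cis_Arg_unique) (auto simp: sgn_div_norm)
  then show ?thesis by (simp add: circle_dist_def cis_divide)
qed

text \<open>The argument of \<open>\<Omega> (cis t)\<close> has a continuous branch. It is injective because \<open>\<Omega>\<close> is, and its
increment over a full turn is nonzero by oddness; hence it is strictly monotone. A decreasing branch
is negated, which changes no inner product of values of \<open>\<Omega>\<close>. The increment over a half
turn is then exactly \<open>pi\<close>, so that on intervals of length at most \<open>pi\<close> arc distances are plain
differences and the lower Lipschitz bound passes to the lift.\<close>

lemma circle_angle_lift:
  fixes \<Omega> :: "complex \<Rightarrow> complex"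
  assumes map: "\<Omega> \<in> unit_circle \<rightarrow> unit_circle" and odd: "odd_on_circle \<Omega>"
    and cont: "continuous_on UNIV (\<lambda>s. \<Omega> (cis s))"
    and \<kappa>: "0 < \<kappa>"
    and exp: "\<And>u v. u \<in> unit_circle \<Longrightarrow> v \<in> unit_circle \<Longrightarrow>
                 \<kappa> * circle_dist u v \<le> circle_dist (\<Omega> u) (\<Omega> v)"
  obtains \<omega> :: "real \<Rightarrow> real" where
    "\<And>s t. Re (\<Omega> (cis s) * cnj (\<Omega> (cis t))) = cos (\<omega> s - \<omega> t)"
    "\<And>t. \<omega> (t + pi) = \<omega> t + pi"
    "\<And>s t. s \<le> t \<Longrightarrow> t \<le> s + pi \<Longrightarrow> \<kappa> * (t - s) \<le> \<omega> t - \<omega> s"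
proof -
  have norm1: "cmod (\<Omega> (cis s)) = 1" for s
  proof -
    have "cis s \<in> unit_circle" by simp
    then have "\<Omega> (cis s) \<in> unit_circle" using map by blast
    then show ?thesis by simp
  qed
  have "contractible (UNIV::real set)" by (simp add: convex_imp_contractible)
  then obtain g where g: "continuous_on UNIV g" "\<And>s. \<Omega> (cis s) = exp (g s)"
    using continuous_logarithm_on_contractible[OF cont] norm1
    by (metis UNIV_I norm_zero zero_neq_one)
  define \<phi> where "\<phi> s = Im (g s)" for s
  have cont\<phi>: "continuous_on UNIV \<phi>"
    unfolding \<phi>_def using g(1) by (intro continuous_intros)
  have Re0: "Re (g s) = 0" for s
    using norm1[of s] g(2)[of s] by (simp add: norm_exp_eq_Re)
  have lift: "\<Omega> (cis s) = cis (\<phi> s)" for s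
    using g(2)[of s] Re0[of s] by (simp add: \<phi>_def exp_eq_polar)
  have sep: "circle_dist (cis s) (cis t) = 0" if "\<Omega> (cis s) = \<Omega> (cis t)" for s t
  proof -
    have "circle_dist (\<Omega> (cis s)) (\<Omega> (cis t)) = 0"
      using that norm1[of t] by (auto simp: circle_dist_def)
    then have "\<kappa> * circle_dist (cis s) (cis t) \<le> 0"
      using exp[of "cis s" "cis t"] by simp
    moreover have "circle_dist (cis s) (cis t) \<ge> 0" by (simp add: circle_dist_def)
    ultimately show ?thesis using \<kappa> by (simp add: mult_le_0_iff)
  qed
  have sep': "\<exists>n::int. t - s = 2 * pi * n" if "\<Omega> (cis s) = \<Omega> (cis t)" for s t
  proof -
    have "Arg (cis t / cis s) = 0" using sep[OF that] by (simp add: circle_dist_def)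
    then have "cis (t - s) = 1"
      using cis_Arg[of "cis (t - s)"] by (simp add: cis_divide sgn_div_norm)
    then have "cos (t - s) = 1" by (metis cis.simps(1) one_complex.simps(1))
    then show ?thesis by (auto simp: cos_one_2pi_int mult_ac)
  qed
  \<comment> \<open>Oddness makes \<open>\<phi> (t + pi) - \<phi> t\<close> an odd multiple of \<open>pi\<close>; by continuity it is constant.\<close>
  have oddk: "\<exists>k::int. \<phi> (t + pi) - \<phi> t = (2 * real_of_int k + 1) * pi" for t
  proof -
    have "cis (t + pi) = - cis t" by (simp add: complex_eq_iff)
    then have "\<Omega> (cis (t + pi)) = - \<Omega> (cis t)" using odd by (simp add: odd_on_circle_def)
    then have e: "cis (\<phi> (t + pi)) = - cis (\<phi> t)" using lift by metis
    have "cis (\<phi> (t + pi) - \<phi> t) = cis (\<phi> (t + pi)) / cis (\<phi> t)" by (simp add: cis_divide)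
    also have "\<dots> = -1" using e by simp
    finally have "cos (\<phi> (t + pi) - \<phi> t - pi) = 1" by (simp add: complex_eq_iff)
    then obtain n :: int where "\<phi> (t + pi) - \<phi> t - pi = n * 2 * pi"
      by (subst (asm) cos_one_2pi_int) auto
    then show ?thesis by (intro exI[of _ n]) (simp add: algebra_simps)
  qed
  have "(\<lambda>t. \<phi> (t + pi) - \<phi> t) constant_on UNIV"
  proof (rule continuous_discrete_range_constant)
    show "connected (UNIV::real set)" by simp
    show "continuous_on UNIV (\<lambda>t. \<phi> (t + pi) - \<phi> t)"
      by (intro continuous_intros continuous_on_compose2[OF cont\<phi>]) auto
    fix x :: real
    show "\<exists>e>0. \<forall>y. y \<in> UNIV \<and> (\<phi> (y + pi) - \<phi> y) \<noteq> (\<phi> (x + pi) - \<phi> x) \<longrightarrow>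
             e \<le> norm ((\<phi> (y + pi) - \<phi> y) - (\<phi> (x + pi) - \<phi> x))"
    proof (intro exI[of _ "2 * pi"] conjI allI impI)
      fix y assume y: "y \<in> UNIV \<and> (\<phi> (y + pi) - \<phi> y) \<noteq> (\<phi> (x + pi) - \<phi> x)"
      obtain k l :: int where kl: "\<phi> (y + pi) - \<phi> y = (2 * real_of_int k + 1) * pi"
        "\<phi> (x + pi) - \<phi> x = (2 * real_of_int l + 1) * pi" using oddk by blast
      have "k \<noteq> l" using y kl by auto
      then have "1 \<le> \<bar>real_of_int (k - l)\<bar>" by linarith
      then have "2 * pi * 1 \<le> 2 * pi * \<bar>real_of_int (k - l)\<bar>" by (intro mult_left_mono) auto
      also have "\<dots> = norm ((\<phi> (y + pi) - \<phi> y) - (\<phi> (x + pi) - \<phi> x))"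
      proof -
        have "(2 * real_of_int k + 1) * pi - (2 * real_of_int l + 1) * pi = 2 * pi * real_of_int (k - l)"
          by (simp add: algebra_simps)
        then show ?thesis unfolding kl by (simp add: abs_mult)
      qed
      finally show "2 * pi \<le> norm ((\<phi> (y + pi) - \<phi> y) - (\<phi> (x + pi) - \<phi> x))" by simp
    qed simp
  qed
  then obtain c where c: "\<And>t. \<phi> (t + pi) - \<phi> t = c" unfolding constant_on_def by blast
  obtain k :: int where k: "c = (2 * real_of_int k + 1) * pi" using oddk c by metis
  have c0: "c \<noteq> 0"
  proof
    assume "c = 0"
    then have "real_of_int (2 * k + 1) = 0" using k by simp
    then have "2 * k + 1 = 0" by (simp only: of_int_eq_0_iff)
    then show False by presburger
  qed
  have shiftn: "\<phi> (t + real n * pi) = \<phi> t + real n * c" for t n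
  proof (induction n)
    case (Suc n)
    have "\<phi> (t + real (Suc n) * pi) = \<phi> ((t + real n * pi) + pi)" by (simp add: algebra_simps)
    also have "\<dots> = \<phi> (t + real n * pi) + c" using c[of "t + real n * pi"] by simp
    finally show ?case using Suc by (simp add: algebra_simps)
  qed simp
  have "inj \<phi>"
  proof (rule linorder_injI)
    fix s t :: real assume st: "s < t"
    show "\<phi> s \<noteq> \<phi> t"
    proof
      assume e: "\<phi> s = \<phi> t"
      then obtain n :: int where n: "t - s = 2 * pi * n" using sep' lift by metis
      then have "n > 0" using st by (metis diff_gt_0_iff_gt mult_pos_pos of_int_0_less_iff pi_gt_zero
          zero_less_mult_pos zero_less_numeral)
      then have "t = s + real (nat (2 * n)) * pi" using n by (simp add: algebra_simps)
      then have "\<phi> t = \<phi> s + real (nat (2 * n)) * c" using shiftn by metis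
      then show False using e c0 \<open>n > 0\<close> by simp
    qed
  qed
  then have mono: "strict_mono \<phi> \<or> strict_antimono_on UNIV \<phi>"
    using injective_eq_monotone_map[of UNIV \<phi>] cont\<phi> by auto
  define \<sigma> :: real where "\<sigma> = (if strict_mono \<phi> then 1 else -1)"
  define \<omega> where "\<omega> t = \<sigma> * \<phi> t" for t
  have \<sigma>: "\<sigma> = 1 \<or> \<sigma> = -1" by (simp add: \<sigma>_def)
  have incr: "\<omega> s < \<omega> t" if "s < t" for s t
    using mono that unfolding \<omega>_def \<sigma>_def by (auto simp: strict_mono_def monotone_on_def)
  have cont\<omega>: "continuous_on UNIV \<omega>" unfolding \<omega>_def by (intro continuous_intros cont\<phi>)
  have shift: "\<omega> (t + pi) = \<omega> t + \<sigma> * c" for t using c[of t] by (simp add: \<omega>_def algebra_simps)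
  \<comment> \<open>A larger jump would make \<open>\<omega>\<close> pass through \<open>\<omega> 0 + 2 * pi\<close> strictly inside half a turn.\<close>
  have \<sigma>c: "\<sigma> * c = pi"
  proof -
    obtain j :: int where j: "\<sigma> * c = (2 * real_of_int j + 1) * pi"
    proof (cases "\<sigma> = 1")
      case True then show ?thesis using k that[of k] by simp
    next
      case False
      then have "\<sigma> * c = (2 * real_of_int (- k - 1) + 1) * pi" using k \<sigma> by (simp add: algebra_simps)
      then show ?thesis using that[of "- k - 1"] by simp
    qed
    have "0 < \<sigma> * c" using incr[of 0 pi] shift[of 0] by simp
    then have "0 < 2 * real_of_int j + 1" unfolding j by (simp add: zero_less_mult_iff)
    then have j0: "j \<ge> 0" by linarith
    have "j < 1"
    proof (rule ccontr)
      assume "\<not> j < 1"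
      then have "2 * pi < \<sigma> * c" unfolding j by (intro mult_strict_right_mono) auto
      then have "\<omega> 0 \<le> \<omega> 0 + 2 * pi" "\<omega> 0 + 2 * pi \<le> \<omega> pi" "\<omega> 0 + 2 * pi < \<omega> pi" using shift[of 0] by auto
      then obtain t where t: "0 \<le> t" "t \<le> pi" "\<omega> t = \<omega> 0 + 2 * pi"
        using IVT'[of \<omega> 0 "\<omega> 0 + 2 * pi" pi] continuous_on_subset[OF cont\<omega>, of "{0..pi}"]
        by auto
      have "\<phi> t = \<phi> 0 + 2 * pi \<or> \<phi> t = \<phi> 0 - 2 * pi" using t(3) \<sigma> by (auto simp: \<omega>_def)
      then have "\<Omega> (cis t) = \<Omega> (cis 0)" unfolding lift by (auto simp: complex_eq_iff cos_diff sin_diff)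
      then have "circle_dist (cis 0) (cis t) = 0" using sep by metis
      then have "t = 0" using circle_dist_cis[of t 0] t by auto
      then show False using t(3) by simp
    qed
    then show ?thesis using j j0 by simp
  qed
  show ?thesis
  proof (rule that[of \<omega>])
    fix s t
    have "cos (\<phi> s - \<phi> t) = cos (\<omega> s - \<omega> t)"
      using \<sigma> cos_minus[of "\<phi> s - \<phi> t"] by (auto simp: \<omega>_def)
    then show "Re (\<Omega> (cis s) * cnj (\<Omega> (cis t))) = cos (\<omega> s - \<omega> t)"
      unfolding lift by (simp add: cis_cnj cis_mult)
  next
    fix t show "\<omega> (t + pi) = \<omega> t + pi" using shift \<sigma>c by simp
  next
    fix s t :: real assume st: "s \<le> t" "t \<le> s + pi"
    have "\<omega> s \<le> \<omega> t" using incr[of s t] st by (cases "s = t") auto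
    moreover have "\<omega> t \<le> \<omega> s + pi"
      using incr[of t "s + pi"] st shift[of s] \<sigma>c by (cases "t = s + pi") auto
    moreover have "\<bar>\<phi> t - \<phi> s\<bar> = \<bar>\<omega> t - \<omega> s\<bar>" using \<sigma> by (auto simp: \<omega>_def)
    ultimately have "\<bar>\<phi> t - \<phi> s\<bar> \<le> pi" "\<bar>\<phi> t - \<phi> s\<bar> = \<omega> t - \<omega> s" by auto
    then have "circle_dist (\<Omega> (cis s)) (\<Omega> (cis t)) = \<omega> t - \<omega> s"
      unfolding lift using circle_dist_cis by simp
    moreover have "circle_dist (cis s) (cis t) = t - s" using circle_dist_cis st by simp
    ultimately show "\<kappa> * (t - s) \<le> \<omega> t - \<omega> s" using exp[of "cis s" "cis t"] by simp
  qed
qed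

section \<open>Monotonicity of the degree-zero kernel\<close>

definition unit_kernel :: "(complex \<Rightarrow> complex) \<Rightarrow> complex \<Rightarrow> complex" where
  "unit_kernel \<Omega> z = (if z = 0 then 0 else \<Omega> (sgn z))"

lemma unit_kernel_0 [simp]: "unit_kernel \<Omega> 0 = 0" by (simp add: unit_kernel_def)

lemma kernel_eq_unit_kernel: "kernel \<Omega> z = of_real (cmod z) * unit_kernel \<Omega> z"
  by (simp add: kernel_def unit_kernel_def sgn_eq)

lemma cmod_unit_kernel_le_1:
  assumes "\<Omega> \<in> unit_circle \<rightarrow> unit_circle"
  shows "cmod (unit_kernel \<Omega> z) \<le> 1"
proof (cases "z = 0")
  case False
  then have "sgn z \<in> unit_circle" by (simp add: norm_sgn)
  then have "\<Omega> (sgn z) \<in> unit_circle" using assms by blast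
  then show ?thesis using False by (simp add: unit_kernel_def)
qed simp

lemma cmod_unit_kernel:
  assumes "\<Omega> \<in> unit_circle \<rightarrow> unit_circle" "z \<noteq> 0"
  shows "cmod (unit_kernel \<Omega> z) = 1"
proof -
  have "sgn z \<in> unit_circle" using assms by (simp add: norm_sgn)
  then have "\<Omega> (sgn z) \<in> unit_circle" using assms by blast
  then show ?thesis using assms by (simp add: unit_kernel_def)
qed

lemma unit_kernel_minus:
  assumes "odd_on_circle \<Omega>"
  shows "unit_kernel \<Omega> (- z) = - unit_kernel \<Omega> z"
  using assms by (auto simp: unit_kernel_def odd_on_circle_def norm_sgn sgn_minus)

lemma unit_kernel_of_real_mult:
  assumes "odd_on_circle \<Omega>"
  shows "unit_kernel \<Omega> (of_real t * e) = of_real (sgn t) * unit_kernel \<Omega> e"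
proof -
  consider "t = 0" | "t > 0" | "t < 0" by linarith
  then show ?thesis
  proof cases
    case 2
    then show ?thesis by (simp add: unit_kernel_def sgn_mult sgn_of_real)
  next
    case 3
    have "unit_kernel \<Omega> (of_real t * e) = - unit_kernel \<Omega> (of_real (- t) * e)"
      using unit_kernel_minus[OF assms, of "of_real (- t) * e"] by simp
    also have "unit_kernel \<Omega> (of_real (- t) * e) = unit_kernel \<Omega> e"
      using 3 by (simp add: unit_kernel_def sgn_mult sgn_of_real del: of_real_minus)
    finally show ?thesis using 3 by simp
  qed simp
qed

text \<open>For the identity and unit \<open>e\<close> this is the increment, from \<open>v\<close> to \<open>v + e\<close>, of the component along \<open>e\<close>
of the gradient of the norm.\<close>

definition monotone_gap :: "(complex \<Rightarrow> complex) \<Rightarrow> complex \<Rightarrow> complex \<Rightarrow> real" where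
  "monotone_gap \<Omega> v e = Re ((unit_kernel \<Omega> (v + e) - unit_kernel \<Omega> v) * cnj (unit_kernel \<Omega> e))"

text \<open>The substitution exchanges the endpoints \<open>v\<close> and \<open>v + e\<close> up to sign, and it reflects the two
half planes bounded by the line through \<open>e\<close> into each other; it reduces estimates to one of them.\<close>

lemma monotone_gap_flip:
  assumes "odd_on_circle \<Omega>"
  shows "monotone_gap \<Omega> (- v - e) e = monotone_gap \<Omega> v e"
proof -
  have "unit_kernel \<Omega> (- v - e + e) = - unit_kernel \<Omega> v"
    using unit_kernel_minus[OF assms, of v] by simp
  moreover have "unit_kernel \<Omega> (- v - e) = - unit_kernel \<Omega> (v + e)"
    using unit_kernel_minus[OF assms, of "v + e"] by simp
  ultimately show ?thesis unfolding monotone_gap_def by (simp only: diff_minus_eq_add minus_diff_minus) (simp add: algebra_simps)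
qed

lemma sin_ge_sin_inner:
  fixes b z :: real
  assumes "0 \<le> b" "b \<le> z" "z \<le> pi - b"
  shows "sin b \<le> sin z"
proof (cases "z \<le> pi / 2")
  case True then show ?thesis using assms by (intro sin_monotone_2pi_le) auto
next
  case False
  have "sin b \<le> sin (pi - z)" using assms False by (intro sin_monotone_2pi_le) auto
  then show ?thesis by simp
qed

text \<open>The form in which \<open>\<Omega>\<close> is used from here on: only inner products of its values matter, and these
are cosines of differences of an angle function \<open>\<omega>\<close> with the properties provided by
\<open>circle_angle_lift\<close>.\<close>

locale angle_lift =
  fixes \<Omega> :: "complex \<Rightarrow> complex" and \<omega> :: "real \<Rightarrow> real" and \<kappa> :: real
  assumes map: "\<Omega> \<in> unit_circle \<rightarrow> unit_circle" and odd: "odd_on_circle \<Omega>"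
    and \<kappa>: "0 < \<kappa>"
    and lift: "\<And>s t. Re (\<Omega> (cis s) * cnj (\<Omega> (cis t))) = cos (\<omega> s - \<omega> t)"
    and half_turn: "\<And>t. \<omega> (t + pi) = \<omega> t + pi"
    and expand: "\<And>s t. s \<le> t \<Longrightarrow> t \<le> s + pi \<Longrightarrow> \<kappa> * (t - s) \<le> \<omega> t - \<omega> s"
begin

lemma \<kappa>_le_1: "\<kappa> \<le> 1"
proof -
  have "\<kappa> * pi \<le> 1 * pi" using expand[of 0 pi] half_turn[of 0] by simp
  then show ?thesis by (rule mult_right_le_imp_le) simp
qed

lemma unit_kernel_inner:
  assumes "e \<noteq> 0" "w \<noteq> 0"
  shows "Re (unit_kernel \<Omega> (w * e) * cnj (unit_kernel \<Omega> e))
           = cos (\<omega> (Arg e + Arg w) - \<omega> (Arg e))"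
proof -
  have "sgn (w * e) = cis (Arg e + Arg w)" using assms
    by (simp add: sgn_mult cis_Arg flip: cis_mult)
  moreover have "sgn e = cis (Arg e)" using assms by (simp add: cis_Arg)
  ultimately show ?thesis using assms lift by (simp add: unit_kernel_def)
qed

text \<open>With \<open>a\<close> and \<open>b\<close> the angles from \<open>e\<close> to \<open>(w + 1) e\<close> and to \<open>w e\<close>, adding \<open>e\<close> turns towards \<open>e\<close>:
\<open>0 < a < b < pi\<close>. The lift sends these to angles \<open>0 < p < q < pi\<close>, and the gap is \<open>cos p - cos q\<close>.
By the mean value theorem it equals \<open>(q - p) sin z\<close>, where \<open>q - p \<ge> \<kappa> (b - a)\<close> and
\<open>sin (b - a) = Im w / (|w| |w + 1|)\<close>. The parameter \<open>s\<close> measures how far the directions stay away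
from that of \<open>e\<close>, hence \<open>z\<close> from \<open>0\<close> and \<open>pi\<close>.\<close>

lemma monotone_gap_upper_half_plane:
  assumes e: "e \<noteq> 0" and w: "Im w > 0"
    and s: "0 \<le> s" "s * cmod w \<le> Im w" "s * cmod (w + 1) \<le> Im w"
  shows "sin (\<kappa> * s) * (\<kappa> * Im w / (cmod w * cmod (w + 1))) \<le> monotone_gap \<Omega> (w * e) e"
proof -
  have nz: "w \<noteq> 0" "w + 1 \<noteq> 0" using w by (auto simp: complex_eq_iff)
  define a b where "a = Arg (w + 1)" and "b = Arg w"
  have ab: "0 < a" "a < pi" "0 < b" "b < pi"
    using w Arg_lt_pi[of w] Arg_lt_pi[of "w + 1"] by (auto simp: a_def b_def)
  have sin_a: "sin a = Im w / cmod (w + 1)" and sin_b: "sin b = Im w / cmod w"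
    using nz by (simp_all add: a_def b_def sin_Arg)
  have sin_diff: "sin (b - a) = Im w / (cmod w * cmod (w + 1))"
    using nz unfolding sin_diff sin_a sin_b
    by (simp add: a_def b_def cos_Arg field_simps)
  have "b - a > 0"
  proof (rule ccontr)
    assume "\<not> b - a > 0"
    then have "sin (a - b) \<ge> 0" using ab by (intro sin_ge_zero) auto
    moreover have "sin (b - a) > 0" unfolding sin_diff using w nz by simp
    moreover have "sin (a - b) = - sin (b - a)" by (metis minus_diff_eq sin_minus)
    ultimately show False by simp
  qed
  then have ba: "b - a > 0" .
  then have sin_ba: "0 \<le> sin (b - a)" using ab by (intro sin_ge_zero) auto
  define p q where "p = \<omega> (Arg e + a) - \<omega> (Arg e)" and "q = \<omega> (Arg e + b) - \<omega> (Arg e)"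
  have "s \<le> sin a" using s(3) nz by (simp add: sin_a pos_le_divide_eq)
  then have "s \<le> a" using sin_x_le_x[of a] ab by simp
  moreover have "\<kappa> * a \<le> p" using expand[of "Arg e" "Arg e + a"] ab by (simp add: p_def)
  ultimately have p: "\<kappa> * s \<le> p" using \<kappa> by (meson mult_left_mono less_imp_le order_trans)
  have "s \<le> sin (pi - b)" using s(2) nz by (simp add: sin_b pos_le_divide_eq)
  then have "s \<le> pi - b" using sin_x_le_x[of "pi - b"] ab by simp
  moreover have "\<kappa> * (pi - b) \<le> pi - q"
    using expand[of "Arg e + b" "Arg e + pi"] ab half_turn[of "Arg e"] by (simp add: q_def)
  ultimately have q: "q \<le> pi - \<kappa> * s"
    using mult_left_mono[of s "pi - b" \<kappa>] \<kappa> by linarith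
  have qp: "\<kappa> * (b - a) \<le> q - p"
    using expand[of "Arg e + a" "Arg e + b"] ab ba by (simp add: p_def q_def)
  then have pq: "p < q" using mult_pos_pos[OF \<kappa> ba] by linarith
  obtain z where z: "p < z" "z < q" "cos q - cos p = (q - p) * (- sin z)"
    using MVT2[OF pq, of cos "\<lambda>x. - sin x"] DERIV_cos by blast
  have s0: "0 \<le> \<kappa> * s" using s \<kappa> by simp
  have "sin (\<kappa> * s) \<le> sin z" using s0 p q z by (intro sin_ge_sin_inner) auto
  moreover have "0 \<le> sin (\<kappa> * s)" using s0 p q pq by (intro sin_ge_zero) auto
  moreover have "\<kappa> * sin (b - a) \<le> q - p"
    using qp sin_x_le_x[of "b - a"] ba \<kappa> mult_left_mono[of "sin (b - a)" "b - a" \<kappa>] by linarith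
  ultimately have "sin (\<kappa> * s) * (\<kappa> * sin (b - a)) \<le> sin z * (q - p)"
    using pq \<kappa> sin_ba by (intro mult_mono) auto
  also have "\<dots> = cos p - cos q" using z by (simp add: algebra_simps)
  also have "\<dots> = monotone_gap \<Omega> (w * e) e"
    using unit_kernel_inner[OF e nz(1)] unit_kernel_inner[OF e nz(2)]
    by (simp add: monotone_gap_def p_def q_def a_def b_def algebra_simps)
  finally show ?thesis by (simp add: sin_diff)
qed

lemma monotone_gap_cone:
  assumes e: "e \<noteq> 0" and w: "Im w \<noteq> 0"
    and s: "0 \<le> s" "s * cmod w \<le> \<bar>Im w\<bar>" "s * cmod (w + 1) \<le> \<bar>Im w\<bar>"
  shows "sin (\<kappa> * s) * (\<kappa> * \<bar>Im w\<bar> / (cmod w * cmod (w + 1))) \<le> monotone_gap \<Omega> (w * e) e"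
proof (cases "Im w > 0")
  case True then show ?thesis using monotone_gap_upper_half_plane[OF e] s by auto
next
  case False
  define w' where "w' = - w - 1"
  have n: "cmod w' = cmod (w + 1)" "cmod (w' + 1) = cmod w"
    unfolding w'_def by (metis minus_diff_eq norm_minus_cancel diff_minus_eq_add add.commute, simp)
  have "sin (\<kappa> * s) * (\<kappa> * Im w' / (cmod w' * cmod (w' + 1))) \<le> monotone_gap \<Omega> (w' * e) e"
  proof (rule monotone_gap_upper_half_plane[OF e])
    have "Im w' = \<bar>Im w\<bar>" using False by (simp add: w'_def)
    then show "Im w' > 0" "s * cmod w' \<le> Im w'" "s * cmod (w' + 1) \<le> Im w'"
      using w s by (simp_all add: n)
  qed (rule s)
  moreover have "monotone_gap \<Omega> (w' * e) e = monotone_gap \<Omega> (w * e) e"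
    using monotone_gap_flip[OF odd, of "w * e" e] by (simp add: w'_def algebra_simps)
  ultimately show ?thesis using False by (simp add: n) (simp add: w'_def mult.commute)
qed

text \<open>Off the line through \<open>e\<close> this is the cone estimate with aperture parameter \<open>0\<close>; on it, the gap is
a difference of two values of the increasing function \<open>sgn\<close>.\<close>

lemma monotone_gap_nonneg:
  assumes "e \<noteq> 0"
  shows "0 \<le> monotone_gap \<Omega> v e"
proof -
  define w where "w = v / e"
  have v: "v = w * e" using assms by (simp add: w_def)
  show ?thesis
  proof (cases "Im w = 0")
    case False
    then show ?thesis using monotone_gap_cone[OF assms False, of 0] v by simp
  next
    case True
    then have w: "w = of_real (Re w)" by (simp add: complex_eq_iff)
    have v1: "v = of_real (Re w) * e" and v2: "v + e = of_real (Re w + 1) * e"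
      using v w by (simp, metis (no_types) distrib_right mult_1 of_real_1 of_real_add)
    have "monotone_gap \<Omega> v e = (sgn (Re w + 1) - sgn (Re w)) * Re (unit_kernel \<Omega> e * cnj (unit_kernel \<Omega> e))"
      unfolding monotone_gap_def v2 unfolding v1 unit_kernel_of_real_mult[OF odd]
      by (simp add: algebra_simps)
    also have "\<dots> = sgn (Re w + 1) - sgn (Re w)"
      using cmod_unit_kernel[OF map assms] by (simp flip: complex_norm_square)
    also have "\<dots> \<ge> 0" by (auto simp: sgn_if)
    finally show ?thesis .
  qed
qed

text \<open>The gap decays only like the inverse distance away from the direction of \<open>e\<close>, which is too slow to
be integrable against a 1-regular measure. The factor \<open>2\<close> in the transversality condition leaves
room for the shift from \<open>v\<close> to \<open>v + e\<close>, whose norm is at most \<open>2 |v|\<close>.\<close>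

lemma monotone_gap_far:
  assumes e: "e \<noteq> 0" and s: "0 < s" "\<kappa> * s < pi" and v: "cmod e \<le> cmod v"
    and tr: "2 * s * (cmod v * cmod e) \<le> \<bar>Im (v * cnj e)\<bar>"
  shows "sin (\<kappa> * s) * \<kappa> * s * cmod e / cmod v \<le> monotone_gap \<Omega> v e"
proof -
  define w where "w = v / e"
  have v': "v = w * e" using e by (simp add: w_def)
  have cw: "cmod w = cmod v / cmod e" by (simp add: w_def norm_divide)
  have w1: "1 \<le> cmod w" using v e by (simp add: cw)
  have "v * cnj e = w * (e * cnj e)" by (simp add: v')
  then have "v * cnj e = w * of_real ((cmod e)\<^sup>2)" by (simp only: complex_norm_square)
  then have "Im (v * cnj e) = Im w * (cmod e)\<^sup>2" by simp
  moreover have "cmod v * cmod e = cmod w * (cmod e)\<^sup>2" by (simp add: v' norm_mult power2_eq_square)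
  ultimately have "(2 * s * cmod w) * (cmod e)\<^sup>2 \<le> \<bar>Im w\<bar> * (cmod e)\<^sup>2"
    using tr by (simp add: abs_mult mult_ac)
  then have im: "2 * s * cmod w \<le> \<bar>Im w\<bar>" using e by simp
  have w2: "cmod (w + 1) \<le> 2 * cmod w" using norm_triangle_ineq[of w 1] w1 by simp
  have "s * cmod (w + 1) \<le> s * (2 * cmod w)" using s(1) w2 by (intro mult_left_mono) auto
  then have c2: "s * cmod (w + 1) \<le> \<bar>Im w\<bar>" using im by simp
  have c1: "s * cmod w \<le> \<bar>Im w\<bar>" 
  proof -
    have "0 \<le> s * cmod w" using s(1) by simp
    then show ?thesis using im by linarith
  qed
  have pos: "0 < s * cmod w" using s(1) w1 by (intro mult_pos_pos) auto
  then have imnz: "Im w \<noteq> 0" using c1 by auto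
  then have wnz: "w + 1 \<noteq> 0" by (auto simp: complex_eq_iff)
  have "sin (\<kappa> * s) * (\<kappa> * (s / cmod w)) \<le>
      sin (\<kappa> * s) * (\<kappa> * (\<bar>Im w\<bar> / (cmod w * cmod (w + 1))))"
  proof (intro mult_left_mono)
    have "s * cmod (w + 1) \<le> \<bar>Im w\<bar>" by (rule c2)
    then have "s \<le> \<bar>Im w\<bar> / cmod (w + 1)" using wnz by (simp add: pos_le_divide_eq)
    then have "s / cmod w \<le> \<bar>Im w\<bar> / cmod (w + 1) / cmod w" using w1 by (intro divide_right_mono) auto
    then show "s / cmod w \<le> \<bar>Im w\<bar> / (cmod w * cmod (w + 1))" by (simp add: mult.commute)
    show "0 \<le> sin (\<kappa> * s)" using s \<kappa> by (intro sin_ge_zero) auto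
  qed (use \<kappa> in auto)
  also have "\<dots> \<le> monotone_gap \<Omega> v e"
    using monotone_gap_cone[OF e imnz _ c1 c2] s by (simp add: v')
  finally show ?thesis using e by (simp add: cw)
qed

end

text \<open>Expand \<open>v\<close> in the basis \<open>e1, e2\<close>: by Cramer's rule the coefficients are the cross products
\<open>Im (v * cnj e2)\<close> and \<open>Im (v * cnj e1)\<close> over the determinant \<open>Im (e1 * cnj e2)\<close>, so they
cannot both be small.\<close>

lemma transversal_to_one:
  fixes v e1 e2 :: complex
  assumes "s * (2 * cmod e1 * cmod e2) \<le> \<bar>Im (e1 * cnj e2)\<bar>"
  shows "s * (cmod v * cmod e1) \<le> \<bar>Im (v * cnj e1)\<bar> \<or> s * (cmod v * cmod e2) \<le> \<bar>Im (v * cnj e2)\<bar>"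
proof (rule ccontr)
  assume n: "\<not> ?thesis"
  have id: "of_real (Im (e1 * cnj e2)) * v = of_real (Im (v * cnj e2)) * e1 - of_real (Im (v * cnj e1)) * e2"
    by (simp add: complex_eq_iff algebra_simps)
  have "\<bar>Im (e1 * cnj e2)\<bar> * cmod v = cmod (of_real (Im (e1 * cnj e2)) * v)" by (simp only: norm_mult norm_of_real)
  also have "\<dots> \<le> \<bar>Im (v * cnj e2)\<bar> * cmod e1 + \<bar>Im (v * cnj e1)\<bar> * cmod e2"
    unfolding id by (rule order_trans[OF norm_triangle_ineq4]) (simp only: norm_mult norm_of_real order_refl)
  also have "\<dots> \<le> s * (cmod v * cmod e2) * cmod e1 + s * (cmod v * cmod e1) * cmod e2"
    using n by (intro add_mono mult_right_mono) auto
  finally have le: "\<bar>Im (e1 * cnj e2)\<bar> * cmod v \<le> s * (2 * cmod e1 * cmod e2) * cmod v"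
    by (simp add: algebra_simps)
  have "e1 \<noteq> 0 \<and> e2 \<noteq> 0 \<and> v \<noteq> 0" using n by auto
  then have pos: "cmod e1 > 0" "cmod e2 > 0" by auto
  have "\<bar>Im (v * cnj e2)\<bar> * cmod e1 + \<bar>Im (v * cnj e1)\<bar> * cmod e2
       < s * (cmod v * cmod e2) * cmod e1 + s * (cmod v * cmod e1) * cmod e2"
    using n pos by (intro add_strict_mono mult_strict_right_mono) auto
  moreover have "s * (cmod v * cmod e2) * cmod e1 + s * (cmod v * cmod e1) * cmod e2
      \<le> \<bar>Im (e1 * cnj e2)\<bar> * cmod v"
    using mult_right_mono[OF assms, of "cmod v"] by (simp add: algebra_simps)
  moreover have "\<bar>Im (e1 * cnj e2)\<bar> * cmod v \<le> \<bar>Im (v * cnj e2)\<bar> * cmod e1 + \<bar>Im (v * cnj e1)\<bar> * cmod e2"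
    using \<open>cmod (of_real (Im (e1 * cnj e2)) * v) \<le> _\<close> \<open>\<bar>Im (e1 * cnj e2)\<bar> * cmod v = _\<close> by simp
  ultimately show False by linarith
qed

section \<open>Radial averages of a symmetric measure\<close>

text \<open>Continuity is known in the angle coordinate only, so \<open>sgn z\<close> is written as the \<open>cis\<close> of a
measurable branch of the argument.\<close>

lemma borel_measurable_unit_kernel:
  assumes "continuous_on UNIV (\<lambda>s. \<Omega> (cis s))"
  shows "unit_kernel \<Omega> \<in> borel_measurable borel"
proof -
  define A :: "complex \<Rightarrow> real" where "A z = (if z \<in> - \<real>\<^sub>\<le>\<^sub>0 then Arg z else pi)" for z
  have "open (- \<real>\<^sub>\<le>\<^sub>0 :: complex set)" by (simp add: closed_nonpos_Reals_complex open_Compl)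
  then have "A \<in> borel_measurable borel"
    unfolding A_def by (intro borel_measurable_continuous_on_if continuous_on_Arg) auto
  moreover have "(\<lambda>s. \<Omega> (cis s)) \<in> borel_measurable borel"
    using assms by (rule borel_measurable_continuous_onI)
  ultimately have "(\<lambda>z. if z = 0 then 0 else \<Omega> (cis (A z))) \<in> borel_measurable borel"
    by measurable
  moreover have "(\<lambda>z. if z = 0 then 0 else \<Omega> (cis (A z))) = unit_kernel \<Omega>"
  proof
    fix z :: complex
    have "A z = Arg z" if "z \<noteq> 0"
      using that Arg_eq_pi[of z] by (auto simp: A_def complex_nonpos_Reals_iff complex_eq_iff)
    then show "(if z = 0 then 0 else \<Omega> (cis (A z))) = unit_kernel \<Omega> z"
      by (simp add: unit_kernel_def cis_Arg)
  qed
  ultimately show ?thesis by simp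
qed

lemma open_compl_spt: "open (- spt \<mu>)"
  unfolding open_subopen[of "- spt \<mu>"] by (fastforce simp: spt_def)

lemma emeasure_compl_spt:
  fixes \<mu> :: "'a::second_countable_topology measure"
  assumes "sets \<mu> = sets borel"
  shows "emeasure \<mu> (- spt \<mu>) = 0"
proof -
  define F where "F = {U. open U \<and> emeasure \<mu> U = 0}"
  obtain F' where F': "F' \<subseteq> F" "countable F'" "\<Union>F' = \<Union>F"
    using Lindelof[of F] unfolding F_def by blast
  have "- spt \<mu> = \<Union>F" by (auto simp: spt_def F_def not_gr_zero)
  moreover have "(\<Union>U\<in>F'. U) \<in> null_sets \<mu>"
    using F' assms by (intro null_sets_UN') (auto simp: F_def null_sets_def)
  ultimately show ?thesis using F' by (simp add: null_sets_def)
qed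

text \<open>The measures with densities the positive and the negative part of \<open>g\<close>, pushed forward by the distance
to \<open>x\<close>, agree on all initial intervals by hypothesis; hence they agree.\<close>

lemma radial_balance:
  fixes \<mu> :: "'a::{metric_space, second_countable_topology} measure" and g :: "'a \<Rightarrow> real"
  assumes sets[measurable_cong]: "sets \<mu> = sets borel"
    and fin: "\<And>r. emeasure \<mu> (ball x r) < \<infinity>"
    and g[measurable]: "g \<in> borel_measurable borel" and bound: "\<And>y. \<bar>g y\<bar> \<le> dist x y"
    and zero: "\<And>r. r > 0 \<Longrightarrow> (LINT y:ball x r|\<mu>. g y) = 0"
    and h[measurable]: "h \<in> borel_measurable borel"
  shows "(\<integral>\<^sup>+y. ennreal (g y) * h (dist x y) \<partial>\<mu>) = (\<integral>\<^sup>+y. ennreal (- g y) * h (dist x y) \<partial>\<mu>)"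
proof -
  have [measurable]: "ball z r \<in> sets borel" for z :: 'a and r by simp
  \<comment> \<open>Distances are negated because rays to the right determine a measure that is finite on them.\<close>
  define N where "N s = distr (density \<mu> (\<lambda>y. ennreal (s * g y))) borel (\<lambda>y. - dist x y)" for s :: real
  have N_emeasure: "emeasure (N s) {t<..} = (\<integral>\<^sup>+y. ennreal (s * g y) * indicator (ball x (- t)) y \<partial>\<mu>)"
    for s t
  proof -
    have "emeasure (N s) {t<..} = emeasure (density \<mu> (\<lambda>y. ennreal (s * g y)))
            ((\<lambda>y. - dist x y) -` {t<..} \<inter> space (density \<mu> (\<lambda>y. ennreal (s * g y))))"
      unfolding N_def by (intro emeasure_distr) measurable
    also have "(\<lambda>y. - dist x y) -` {t<..} \<inter> space (density \<mu> (\<lambda>y. ennreal (s * g y))) = ball x (- t)"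
      using sets_eq_imp_space_eq[OF sets] by (auto simp: mem_ball)
    also have "emeasure (density \<mu> (\<lambda>y. ennreal (s * g y))) (ball x (- t)) =
        (\<integral>\<^sup>+y. ennreal (s * g y) * indicator (ball x (- t)) y \<partial>\<mu>)"
      by (intro emeasure_density) measurable
    finally show ?thesis .
  qed
  have finite_part: "(\<integral>\<^sup>+y. ennreal (s * g y) * indicator (ball x r) y \<partial>\<mu>) < \<infinity>" if "\<bar>s\<bar> = 1" for s r
  proof -
    have "(\<integral>\<^sup>+y. ennreal (s * g y) * indicator (ball x r) y \<partial>\<mu>)
        \<le> (\<integral>\<^sup>+y. ennreal r * indicator (ball x r) y \<partial>\<mu>)"
    proof (intro nn_integral_mono)
      fix y
      have "s * g y \<le> \<bar>g y\<bar>" using that by (metis abs_ge_self abs_mult mult_1)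
      then have "s * g y \<le> r" if "dist x y < r" using bound[of y] that by linarith
      then show "ennreal (s * g y) * indicator (ball x r) y \<le> ennreal r * indicator (ball x r) y"
        by (auto simp: indicator_def intro!: ennreal_leI)
    qed
    also have "\<dots> = ennreal r * emeasure \<mu> (ball x r)"
      by (intro nn_integral_cmult_indicator) (simp add: sets)
    also have "\<dots> < \<infinity>" using fin[of r] by (simp add: ennreal_mult_less_top)
    finally show ?thesis .
  qed
  have eq: "N 1 = N (-1)"
  proof (rule measure_eqI_lessThan)
    show "sets (N 1) = sets borel" "sets (N (-1)) = sets borel" by (simp_all add: N_def)
    show "emeasure (N 1) {t<..} < \<infinity>" for t unfolding N_emeasure by (rule finite_part) simp
    show "emeasure (N 1) {t<..} = emeasure (N (-1)) {t<..}" for t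
    proof (cases "- t > 0")
      case False
      then have empty: "ball x (- t) = {}" by simp
      show ?thesis unfolding N_emeasure empty by simp
    next
      case True
      define f where "f y = indicator (ball x (- t)) y *\<^sub>R g y" for y
      have f: "f \<in> borel_measurable \<mu>" unfolding f_def by measurable
      have int: "integrable \<mu> f"
      proof (rule integrableI_bounded_set[where A = "ball x (- t)" and B = "- t"])
        show "AE y in \<mu>. y \<in> ball x (- t) \<longrightarrow> norm (f y) \<le> - t"
          using bound by (intro AE_I2) (auto simp: f_def intro: order_trans less_imp_le)
      qed (use f fin in \<open>auto simp: f_def sets\<close>)
      have fp: "(\<integral>\<^sup>+y. ennreal (f y) \<partial>\<mu>) = emeasure (N 1) {t<..}"
        unfolding N_emeasure by (intro nn_integral_cong) (simp add: f_def indicator_def)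
      have fm: "(\<integral>\<^sup>+y. ennreal (- f y) \<partial>\<mu>) = emeasure (N (-1)) {t<..}"
        unfolding N_emeasure by (intro nn_integral_cong) (simp add: f_def indicator_def)
      have "0 = integral\<^sup>L \<mu> f" using zero[OF True] unfolding f_def[abs_def] set_lebesgue_integral_def by simp
      also have "\<dots> = enn2real (emeasure (N 1) {t<..}) - enn2real (emeasure (N (-1)) {t<..})"
        using real_lebesgue_integral_def[OF int] by (simp add: fp fm)
      finally have "enn2real (emeasure (N 1) {t<..}) = enn2real (emeasure (N (-1)) {t<..})" by simp
      moreover have "emeasure (N 1) {t<..} < \<infinity>" "emeasure (N (-1)) {t<..} < \<infinity>"
        unfolding N_emeasure by (rule finite_part, simp)+
      ultimately show ?thesis by (metis ennreal_enn2real infinity_ennreal_def)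
    qed
  qed
  have N_nn: "(\<integral>\<^sup>+t. h (- t) \<partial>N s) = (\<integral>\<^sup>+y. ennreal (s * g y) * h (dist x y) \<partial>\<mu>)" for s
    unfolding N_def by (subst nn_integral_distr, measurable, simp, subst nn_integral_density) measurable
  show ?thesis using N_nn[of 1] N_nn[of "-1"] unfolding eq by simp
qed

text \<open>The cutoff has to equal \<open>1\<close> up to \<open>O(r / L)\<close> near \<open>0\<close>, vanish beyond \<open>L\<close> and have Lipschitz
constant \<open>O(1 / L)\<close>: moving its centre by \<open>d\<close> then costs \<open>d / L\<close> on a ball of mass \<open>O(L)\<close>.\<close>

definition tent :: "real \<Rightarrow> real \<Rightarrow> real" where
  "tent L r = max 0 (1 - r / L)"

lemma tent_bounds:
  assumes "0 < L" "0 \<le> r"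
  shows "0 \<le> tent L r \<and> tent L r \<le> 1"
proof -
  have "0 \<le> r / L" using assms by simp
  then show ?thesis unfolding tent_def by linarith
qed

lemma tent_eq_0:
  assumes "0 < L" "L \<le> r"
  shows "tent L r = 0"
proof -
  have "1 \<le> r / L" using assms by simp
  then show ?thesis unfolding tent_def by linarith
qed

lemma tent_ge_half:
  assumes "0 < L" "r \<le> L / 2"
  shows "1 / 2 \<le> tent L r"
proof -
  have "r / L \<le> 1 / 2" using assms by (simp add: pos_divide_le_eq)
  then show ?thesis unfolding tent_def by linarith
qed

lemma tent_lipschitz:
  assumes "0 < L"
  shows "\<bar>tent L r - tent L s\<bar> \<le> \<bar>r - s\<bar> / L"
proof -
  have "\<bar>tent L r - tent L s\<bar> \<le> \<bar>(1 - r / L) - (1 - s / L)\<bar>"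
    unfolding tent_def by linarith
  also have "\<dots> = \<bar>(s - r) / L\<bar>" by (simp add: diff_divide_distrib)
  also have "\<dots> = \<bar>r - s\<bar> / L" using assms by (simp add: abs_minus_commute)
  finally show ?thesis .
qed

locale symmetric_regular = angle_lift +
  fixes \<mu> :: "complex measure" and C :: real
  assumes cont: "continuous_on UNIV (\<lambda>s. \<Omega> (cis s))"
    and sets_mu[measurable_cong]: "sets \<mu> = sets borel"
    and nonzero: "emeasure \<mu> (space \<mu>) \<noteq> 0"
    and C: "0 < C" and regular: "ahlfors_1_regular_with C \<mu>"
    and symmetric: "symmetric_measure \<Omega> \<mu>"
begin

lemma unit_kernel_measurable[measurable]: "unit_kernel \<Omega> \<in> borel_measurable borel"
  using cont by (rule borel_measurable_unit_kernel)

lemma ball_measurable[measurable]: "ball z r \<in> sets borel" for z :: complex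
  by simp

lemma space_mu [simp]: "space \<mu> = UNIV"
  using sets_eq_imp_space_eq[OF sets_mu] by simp

lemma spt_nonempty: "spt \<mu> \<noteq> {}"
proof
  assume "spt \<mu> = {}"
  then show False using emeasure_compl_spt[OF sets_mu] nonzero by simp
qed

lemma ball_upper: "x \<in> spt \<mu> \<Longrightarrow> r > 0 \<Longrightarrow> emeasure \<mu> (ball x r) \<le> ennreal (C * r)"
  and ball_lower: "x \<in> spt \<mu> \<Longrightarrow> r > 0 \<Longrightarrow> ennreal (r / C) \<le> emeasure \<mu> (ball x r)"
proof -
  assume "x \<in> spt \<mu>" "r > 0"
  then have "ennreal (inverse C * r) \<le> emeasure \<mu> (ball x r) \<and> emeasure \<mu> (ball x r) \<le> ennreal (C * r)"
    using regular by (simp add: ahlfors_1_regular_with_def)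
  moreover have "inverse C * r = r / C" by (simp add: field_simps)
  ultimately show "emeasure \<mu> (ball x r) \<le> ennreal (C * r)" "ennreal (r / C) \<le> emeasure \<mu> (ball x r)"
    by simp_all
qed

lemma ball_finite: "emeasure \<mu> (ball z r) < \<infinity>"
proof -
  obtain x where x: "x \<in> spt \<mu>" using spt_nonempty by blast
  have "ball z r \<subseteq> ball x (\<bar>r\<bar> + dist x z + 1)"
  proof
    fix y assume "y \<in> ball z r"
    then show "y \<in> ball x (\<bar>r\<bar> + dist x z + 1)"
      using dist_triangle[of x y z] by simp
  qed
  then have "emeasure \<mu> (ball z r) \<le> emeasure \<mu> (ball x (\<bar>r\<bar> + dist x z + 1))"
    by (intro emeasure_mono) (auto simp: sets_mu)
  also have "\<dots> \<le> ennreal (C * (\<bar>r\<bar> + dist x z + 1))"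
    using ball_upper[OF x, of "\<bar>r\<bar> + dist x z + 1"] by (simp add: add_nonneg_pos)
  also have "\<dots> < \<infinity>" by simp
  finally show ?thesis .
qed

text \<open>The upper regularity bound on small balls excludes atoms in the support.\<close>

lemma emeasure_singleton: "emeasure \<mu> {x} = 0"
proof (cases "x \<in> spt \<mu>")
  case False
  then have "{x} \<subseteq> - spt \<mu>" by simp
  moreover have "- spt \<mu> \<in> sets \<mu>"
    using open_compl_spt[of \<mu>] by (simp add: sets_mu)
  ultimately show ?thesis using emeasure_mono[of "{x}" "- spt \<mu>" \<mu>] emeasure_compl_spt[OF sets_mu] by simp
next
  case True
  have "emeasure \<mu> {x} \<le> 0 + ennreal \<epsilon>" if "\<epsilon> > 0" for \<epsilon>
  proof -
    have "emeasure \<mu> {x} \<le> emeasure \<mu> (ball x (\<epsilon> / C))"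
      using that C by (intro emeasure_mono) (auto simp: sets_mu)
    also have "\<dots> \<le> ennreal \<epsilon>" using ball_upper[OF True, of "\<epsilon> / C"] that C by simp
    finally show ?thesis by simp
  qed
  then have "emeasure \<mu> {x} \<le> 0" by (rule ennreal_le_epsilon)
  then show ?thesis by simp
qed

text \<open>A punctured ball about a point of the support has positive mass, as there are no atoms.\<close>

lemma spt_no_isolated_points:
  assumes x: "x \<in> spt \<mu>" and "\<epsilon> > 0"
  obtains x' where "x' \<in> spt \<mu>" "x' \<noteq> x" "dist x x' < \<epsilon>"
proof (rule ccontr)
  assume "\<not> thesis"
  then have sub: "ball x \<epsilon> \<subseteq> - spt \<mu> \<union> {x}" using that by auto
  have "emeasure \<mu> (ball x \<epsilon>) \<le> emeasure \<mu> (- spt \<mu> \<union> {x})"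
    using sub open_compl_spt[of \<mu>] by (intro emeasure_mono) (auto simp: sets_mu)
  also have "\<dots> \<le> emeasure \<mu> (- spt \<mu>) + emeasure \<mu> {x}"
    using open_compl_spt[of \<mu>] by (intro emeasure_subadditive) (auto simp: sets_mu)
  also have "\<dots> = 0" using emeasure_compl_spt[OF sets_mu] emeasure_singleton by simp
  finally show False using ball_lower[OF x \<open>\<epsilon> > 0\<close>] C \<open>\<epsilon> > 0\<close> by (simp add: ennreal_eq_0_iff divide_le_0_iff)
qed

lemma inner_unit_kernel_le_1:
  assumes "cmod c \<le> 1"
  shows "\<bar>Re (unit_kernel \<Omega> z * c)\<bar> \<le> 1"
proof -
  have "\<bar>Re (unit_kernel \<Omega> z * c)\<bar> \<le> cmod (unit_kernel \<Omega> z * c)"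
    by (rule abs_Re_le_cmod)
  also have "\<dots> = cmod (unit_kernel \<Omega> z) * cmod c" by (rule norm_mult)
  also have "\<dots> \<le> 1 * 1"
    using assms cmod_unit_kernel_le_1[OF map, of z] by (intro mult_mono) auto
  finally show ?thesis by simp
qed

text \<open>The product in the integrand is the component of \<open>kernel \<Omega> (x - y)\<close> along \<open>cnj c\<close>.\<close>

lemma directional_balance:
  assumes x: "x \<in> spt \<mu>" and c: "cmod c \<le> 1" and h: "h \<in> borel_measurable borel"
  shows "(\<integral>\<^sup>+y. ennreal (dist x y * Re (unit_kernel \<Omega> (x - y) * c)) * h (dist x y) \<partial>\<mu>) =
         (\<integral>\<^sup>+y. ennreal (- (dist x y * Re (unit_kernel \<Omega> (x - y) * c))) * h (dist x y) \<partial>\<mu>)"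
proof (rule radial_balance[OF sets_mu ball_finite _ _ _ h])
  show "(\<lambda>y. dist x y * Re (unit_kernel \<Omega> (x - y) * c)) \<in> borel_measurable borel" by measurable
  show "\<bar>dist x y * Re (unit_kernel \<Omega> (x - y) * c)\<bar> \<le> dist x y" for y
    using mult_left_mono[OF inner_unit_kernel_le_1[OF c, of "x - y"], of "dist x y"]
    by (simp add: abs_mult)
  fix r :: real assume r: "r > 0"
  define f where "f y = indicator (ball x r) y *\<^sub>R kernel \<Omega> (x - y)" for y
  have fe: "f y = indicator (ball x r) y *\<^sub>R (of_real (cmod (x - y)) * unit_kernel \<Omega> (x - y))" for y
    by (simp add: f_def kernel_eq_unit_kernel)
  have int: "integrable \<mu> f"
  proof (rule integrableI_bounded_set[where A = "ball x r" and B = r])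
    show "f \<in> borel_measurable \<mu>" unfolding fe by measurable
    have "norm (f y) \<le> r" if "y \<in> ball x r" for y
      using that cmod_unit_kernel_le_1[OF map, of "x - y"] r
        mult_mono[of "cmod (x - y)" r "cmod (unit_kernel \<Omega> (x - y))" 1]
      by (simp add: fe norm_mult dist_norm)
    then show "AE y in \<mu>. y \<in> ball x r \<longrightarrow> norm (f y) \<le> r" by simp
  qed (use ball_finite in \<open>auto simp: f_def sets_mu\<close>)
  have "0 = Re (integral\<^sup>L \<mu> f * c)"
    using symmetric x r
    unfolding f_def[abs_def] symmetric_measure_def set_lebesgue_integral_def by simp
  also have "\<dots> = (\<integral>y. Re (f y * c) \<partial>\<mu>)" using int by simp
  also have "\<dots> = (LINT y:ball x r|\<mu>. dist x y * Re (unit_kernel \<Omega> (x - y) * c))"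
    unfolding set_lebesgue_integral_def
    by (intro Bochner_Integration.integral_cong) (auto simp: fe dist_norm algebra_simps)
  finally show "(LINT y:ball x r|\<mu>. dist x y * Re (unit_kernel \<Omega> (x - y) * c)) = 0" by simp
qed

text \<open>The weight \<open>tent L r / r\<close> cancels the growth of the kernel. It is unbounded at \<open>0\<close>, but its product
with the kernel is bounded by \<open>1\<close> and supported in a ball.\<close>

lemma tent_integral:
  assumes x: "x \<in> spt \<mu>" and c: "cmod c \<le> 1" and L: "0 < L"
  shows "has_bochner_integral \<mu> (\<lambda>y. tent L (dist x y) * Re (unit_kernel \<Omega> (x - y) * c)) 0"
proof -
  define f where "f y = tent L (dist x y) * Re (unit_kernel \<Omega> (x - y) * c)" for y
  have tent_meas[measurable]: "tent L \<in> borel_measurable borel" unfolding tent_def by measurable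
  have int: "integrable \<mu> f"
  proof (rule integrableI_bounded_set[where A = "ball x L" and B = 1])
    show "f \<in> borel_measurable \<mu>" unfolding f_def by measurable
    have "norm (f y) \<le> 1" for y
      using tent_bounds[OF L, of "dist x y"] inner_unit_kernel_le_1[OF c, of "x - y"]
        mult_mono[of "tent L (dist x y)" 1 "\<bar>Re (unit_kernel \<Omega> (x - y) * c)\<bar>" 1]
      by (simp add: f_def abs_mult del: times_complex.sel)
    then show "AE y in \<mu>. y \<in> ball x L \<longrightarrow> norm (f y) \<le> 1" by simp
    show "AE y in \<mu>. y \<notin> ball x L \<longrightarrow> f y = 0"
      using L by (intro AE_I2) (auto simp: f_def tent_eq_0 not_less)
  qed (use ball_finite in \<open>auto simp: sets_mu\<close>)
  define h where "h r = ennreal (tent L r / r)" for r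
  have h: "h \<in> borel_measurable borel" unfolding h_def by measurable
  have eq: "ennreal (s * f y) = ennreal (s * (dist x y * Re (unit_kernel \<Omega> (x - y) * c))) * h (dist x y)" for s y
  proof (cases "x = y")
    case False
    have "s * f y = (s * (dist x y * Re (unit_kernel \<Omega> (x - y) * c))) * (tent L (dist x y) / dist x y)"
      using False by (simp add: f_def)
    moreover have "0 \<le> tent L (dist x y) / dist x y" using tent_bounds[OF L, of "dist x y"] by simp
    ultimately show ?thesis unfolding h_def by (metis ennreal_mult'')
  qed (simp add: f_def)
  have "(\<integral>\<^sup>+y. ennreal (f y) \<partial>\<mu>) = (\<integral>\<^sup>+y. ennreal (- f y) \<partial>\<mu>)"
    using directional_balance[OF x c h] eq[of 1] eq[of "-1"] by (simp del: times_complex.sel)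
  then have "integral\<^sup>L \<mu> f = 0" using real_lebesgue_integral_def[OF int] by simp
  then show ?thesis using int unfolding f_def[symmetric] by (simp add: has_bochner_integral_iff)
qed

text \<open>Subtract the vanishing tent integrals centred at \<open>x\<close> and at \<open>p\<close>. Their difference is the integral of
\<open>tent L (dist p y) * G y\<close> plus an error from the different centres, at most \<open>dist x p / L\<close> pointwise and
supported in \<open>ball p (L + dist x p)\<close>, whose mass is at most \<open>2 C L\<close>. The factor \<open>4\<close> arises because the
tent is only bounded below by \<open>1 / 2\<close> on \<open>ball p (L / 2)\<close>.\<close>

lemma monotone_gap_integral_bound:
  assumes x: "x \<in> spt \<mu>" and p: "p \<in> spt \<mu>" and xp: "x \<noteq> p" and L: "dist x p \<le> L"
  shows "(\<integral>\<^sup>+y. ennreal (monotone_gap \<Omega> (p - y) (x - p)) * indicator (ball p (L / 2)) y \<partial>\<mu>)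
           \<le> ennreal (4 * C * dist x p)"
proof -
  define d where "d = dist x p"
  have d: "0 < d" "d \<le> L" using xp L by (simp_all add: d_def)
  then have L0: "0 < L" by linarith
  define c where "c = cnj (unit_kernel \<Omega> (x - p))"
  have c: "cmod c \<le> 1" using cmod_unit_kernel_le_1[OF map] by (simp add: c_def)
  define A where "A z y = Re (unit_kernel \<Omega> (z - y) * c)" for z y
  have [measurable]: "A z \<in> borel_measurable borel" for z unfolding A_def by measurable
  define G where "G y = A x y - A p y" for y
  have G_eq: "monotone_gap \<Omega> (p - y) (x - p) = G y" for y
    by (simp add: monotone_gap_def G_def A_def c_def algebra_simps)
  have G0: "0 \<le> G y" for y using monotone_gap_nonneg[of "x - p" "p - y"] xp by (simp add: G_eq)
  define g where "g y = G y * indicator (ball p (L / 2)) y" for y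
  have int_g: "integrable \<mu> g"
  proof (rule integrableI_bounded_set[where A = "ball p (L / 2)" and B = 2])
    show "g \<in> borel_measurable \<mu>" unfolding g_def G_def by measurable
    have A1: "\<bar>A z y\<bar> \<le> 1" for z y unfolding A_def using c by (rule inner_unit_kernel_le_1)
    have "\<bar>G y\<bar> \<le> 2" for y
      unfolding G_def using A1[of x y] A1[of p y] by linarith
    then show "AE y in \<mu>. y \<in> ball p (L / 2) \<longrightarrow> norm (g y) \<le> 2" by (simp add: g_def)
  qed (use ball_finite in \<open>auto simp: g_def sets_mu\<close>)
  have ball_real: "measure \<mu> (ball p (L + d)) \<le> C * (L + d)"
    unfolding measure_def using ball_upper[OF p, of "L + d"] d L0 C by (intro enn2real_leI) auto
  define f where "f z y = tent L (dist z y) * A z y" for z y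
  have pointwise: "g y / 2 \<le> f x y - f p y + d / L * indicator (ball p (L + d)) y" for y
  proof -
    define a b where "a = tent L (dist x y)" and "b = tent L (dist p y)"
    have "g y / 2 \<le> b * G y"
    proof (cases "y \<in> ball p (L / 2)")
      case True
      then have "1 / 2 \<le> b" unfolding b_def using L0 by (intro tent_ge_half) auto
      from mult_right_mono[OF this G0] show ?thesis using True by (simp add: g_def)
    next
      case False
      have "0 \<le> b" using tent_bounds[OF L0] by (simp add: b_def)
      then show ?thesis using False G0 by (simp add: g_def)
    qed
    moreover have "- ((a - b) * A x y) \<le> d / L * indicator (ball p (L + d)) y"
    proof (cases "y \<in> ball p (L + d)")
      case True
      have "\<bar>dist x y - dist p y\<bar> \<le> d" unfolding d_def by (metis abs_dist_diff_le dist_commute)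
      then have "\<bar>a - b\<bar> \<le> d / L"
        using tent_lipschitz[OF L0, of "dist x y" "dist p y"] L0
        unfolding a_def b_def by (meson divide_right_mono less_imp_le order_trans)
      moreover have "\<bar>A x y\<bar> \<le> 1" unfolding A_def using c by (rule inner_unit_kernel_le_1)
      ultimately have "\<bar>a - b\<bar> * \<bar>A x y\<bar> \<le> d / L * 1" using d L0 by (intro mult_mono) auto
      then have "\<bar>(a - b) * A x y\<bar> \<le> d / L" by (simp add: abs_mult)
      then show ?thesis using True by (simp add: abs_le_iff del: times_complex.sel)
    next
      case False
      then have "L + d \<le> dist p y" by simp
      moreover then have "L \<le> dist x y" using dist_triangle[of p y x] by (simp add: d_def dist_commute)
      ultimately have "a = 0" "b = 0" unfolding a_def b_def using L0 d by (auto intro: tent_eq_0)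
      then show ?thesis using False by simp
    qed
    moreover have "f x y - f p y = b * G y + (a - b) * A x y"
      by (simp add: f_def a_def b_def G_def algebra_simps)
    ultimately show ?thesis by linarith
  qed
  have hx: "has_bochner_integral \<mu> (f x) 0" and hp: "has_bochner_integral \<mu> (f p) 0"
    unfolding f_def A_def using tent_integral[OF _ c L0] x p by auto
  have ind: "integrable \<mu> (\<lambda>y. d / L * indicator (ball p (L + d)) y :: real)"
    using ball_finite by (intro integrable_mult_right integrable_real_indicator) (auto simp: sets_mu)
  have "(\<integral>y. g y / 2 \<partial>\<mu>) \<le> (\<integral>y. f x y - f p y + d / L * indicator (ball p (L + d)) y \<partial>\<mu>)"
    using hx hp ind int_g pointwise
    by (intro integral_mono) (auto simp: has_bochner_integral_iff)
  also have "\<dots> = d / L * measure \<mu> (ball p (L + d))"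
    using hx hp ind by (simp add: has_bochner_integral_iff sets_mu)
  also have "\<dots> \<le> d / L * (C * (L + d))" using ball_real d L0 by (intro mult_left_mono) auto
  also have "\<dots> \<le> d / L * (C * (2 * L))" using d L0 C by (intro mult_left_mono) auto
  also have "\<dots> = 2 * C * d" using L0 by simp
  finally have "integral\<^sup>L \<mu> g \<le> 4 * C * d" by simp
  moreover have "(\<integral>\<^sup>+y. ennreal (g y) \<partial>\<mu>) = ennreal (integral\<^sup>L \<mu> g)"
    using G0 by (intro nn_integral_eq_integral[OF int_g] AE_I2) (simp add: g_def)
  moreover have "(\<integral>\<^sup>+y. ennreal (monotone_gap \<Omega> (p - y) (x - p)) * indicator (ball p (L / 2)) y \<partial>\<mu>)
      = (\<integral>\<^sup>+y. ennreal (g y) \<partial>\<mu>)"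
    by (intro nn_integral_cong) (simp add: g_def G_eq indicator_def)
  ultimately show ?thesis using ennreal_leI by (simp add: d_def)
qed

end

section \<open>The support lies on a line\<close>

context symmetric_regular
begin

text \<open>The ratio \<open>C\<^sup>2 + C + 1\<close> makes the lower bound for the larger ball exceed the upper bound \<open>C R\<close> for
the smaller one by at least \<open>R\<close>.\<close>

lemma annulus_mass:
  assumes p: "p \<in> spt \<mu>" and R: "0 < R"
  shows "ennreal R \<le> emeasure \<mu> (ball p ((C\<^sup>2 + C + 1) * R) - ball p R)"
proof -
  define q where "q = C\<^sup>2 + C + 1"
  have q: "1 \<le> q" using C by (simp add: q_def)
  have "R \<le> q * R" using q R by simp
  have "R \<le> q * R / C - C * R"
  proof -
    have "q * R / C = (C + 1 + 1 / C) * R" using C by (simp add: q_def power2_eq_square field_simps)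
    then have "q * R / C - C * R = R + R / C" by (simp add: algebra_simps)
    then show ?thesis using C R by simp
  qed
  then have "ennreal R \<le> ennreal (q * R / C - C * R)" by (rule ennreal_leI)
  also have "\<dots> = ennreal (q * R / C) - ennreal (C * R)"
    using C R by (simp add: ennreal_minus)
  also have "\<dots> \<le> emeasure \<mu> (ball p (q * R)) - emeasure \<mu> (ball p R)"
    using ball_lower[OF p, of "q * R"] ball_upper[OF p R] q R by (intro ennreal_minus_mono) auto
  also have "\<dots> = emeasure \<mu> (ball p (q * R) - ball p R)"
    using ball_finite[of p R] \<open>R \<le> q * R\<close>
    by (intro emeasure_Diff[symmetric]) (auto simp: sets_mu subset_ball)
  finally show ?thesis by (simp add: q_def)
qed

text \<open>Each annulus between consecutive radii of a geometric sequence contributes at least the same amount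
\<open>c / q\<close> to the integral of \<open>H\<close>, where \<open>q\<close> is the ratio of the radii.\<close>

lemma log_divergence:
  assumes p: "p \<in> spt \<mu>" and R0: "0 < R0" and c: "0 < c"
    and H: "\<And>y. R0 \<le> dist p y \<Longrightarrow> c / dist p y \<le> H y"
    and Hm[measurable]: "H \<in> borel_measurable borel"
    and bound: "\<And>R. R0 \<le> R \<Longrightarrow> (\<integral>\<^sup>+y. ennreal (H y) * indicator (ball p R) y \<partial>\<mu>) \<le> ennreal M"
  shows False
proof -
  define q where "q = C\<^sup>2 + C + 1"
  have q: "1 \<le> q" using C by (simp add: q_def)
  define I where "I R = (\<integral>\<^sup>+y. ennreal (H y) * indicator (ball p R) y \<partial>\<mu>)" for R
  have step: "I R + ennreal (c / q) \<le> I (q * R)" if R: "R0 \<le> R" for R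
  proof -
    define D where "D = ball p (q * R) - ball p R"
    have [measurable]: "D \<in> sets borel" by (simp add: D_def)
    have Rp: "0 < R" using R R0 by simp
    have qR: "R \<le> q * R" using q Rp by simp
    have "c / q = c / (q * R) * R" using Rp by simp
    then have "ennreal (c / q) = ennreal (c / (q * R) * R)" by (rule arg_cong)
    also have "\<dots> = ennreal (c / (q * R)) * ennreal R" using Rp by (intro ennreal_mult'') simp
    also have "\<dots> \<le> ennreal (c / (q * R)) * emeasure \<mu> D"
      using annulus_mass[OF p Rp] by (intro mult_left_mono) (simp_all add: D_def q_def)
    also have "\<dots> = (\<integral>\<^sup>+y. ennreal (c / (q * R)) * indicator D y \<partial>\<mu>)"
      by (intro nn_integral_cmult_indicator[symmetric]) (simp add: sets_mu)
    finally have "I R + ennreal (c / q) \<le>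
        I R + (\<integral>\<^sup>+y. ennreal (c / (q * R)) * indicator D y \<partial>\<mu>)"
      by (rule add_left_mono)
    also have "\<dots> = (\<integral>\<^sup>+y. ennreal (H y) * indicator (ball p R) y + ennreal (c / (q * R)) * indicator D y \<partial>\<mu>)"
      unfolding I_def by (intro nn_integral_add[symmetric]) measurable
    also have "\<dots> \<le> I (q * R)"
      unfolding I_def
    proof (intro nn_integral_mono)
      fix y
      show "ennreal (H y) * indicator (ball p R) y + ennreal (c / (q * R)) * indicator D y
          \<le> ennreal (H y) * indicator (ball p (q * R)) y"
      proof (cases "y \<in> D")
        case True
        then have y: "R \<le> dist p y" "dist p y < q * R" by (auto simp: D_def)
        have "c / (q * R) \<le> c / dist p y"
          using y c Rp q by (intro divide_left_mono mult_pos_pos) auto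
        also have "\<dots> \<le> H y" using H y R by simp
        finally show ?thesis using True by (simp add: D_def ennreal_leI)
      next
        case False
        then show ?thesis using qR by (auto simp: D_def indicator_def)
      qed
    qed
    finally show ?thesis .
  qed
  have grow: "of_nat n * ennreal (c / q) \<le> I (q ^ n * R0)" for n
  proof (induction n)
    case (Suc n)
    have "R0 \<le> q ^ n * R0" using q R0 one_le_power[of q n] by simp
    then have "I (q ^ n * R0) + ennreal (c / q) \<le> I (q * (q ^ n * R0))" by (rule step)
    moreover have "of_nat (Suc n) * ennreal (c / q) = of_nat n * ennreal (c / q) + ennreal (c / q)"
      by (simp add: distrib_right add.commute)
    moreover have "of_nat n * ennreal (c / q) + ennreal (c / q) \<le> I (q ^ n * R0) + ennreal (c / q)"
      using Suc by (rule add_right_mono)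
    ultimately show ?case by (metis order_trans mult.assoc power_Suc)
  qed simp
  obtain n :: nat where n: "\<bar>M\<bar> < real n * (c / q)"
    using reals_Archimedean3[of "c / q" ] c q by (metis divide_pos_pos less_le_trans zero_less_one)
  have "ennreal (real n * (c / q)) = of_nat n * ennreal (c / q)"
    unfolding ennreal_of_nat_eq_real_of_nat using c q by (intro ennreal_mult) auto
  also have "\<dots> \<le> I (q ^ n * R0)" by (rule grow)
  also have "\<dots> \<le> ennreal M"
    unfolding I_def using q R0 one_le_power[of q n] by (intro bound) simp
  finally have "real n * (c / q) \<le> M \<or> real n * (c / q) \<le> 0" unfolding ennreal_le_iff2 by blast
  then show False using n by auto
qed

lemma monotone_gap_measurable [measurable]:
  "(\<lambda>y. monotone_gap \<Omega> (p - y) e) \<in> borel_measurable borel"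
  unfolding monotone_gap_def by measurable

text \<open>For noncollinear points the two gaps with base point \<open>p\<close> have bounded total integral, yet their sum
dominates a multiple of the inverse distance to \<open>p\<close> in all directions.\<close>

theorem spt_collinear:
  assumes p: "p \<in> spt \<mu>" and x1: "x1 \<in> spt \<mu>" and x2: "x2 \<in> spt \<mu>"
  shows "Im ((x1 - p) * cnj (x2 - p)) = 0"
proof (rule ccontr)
  define e1 e2 where "e1 = x1 - p" and "e2 = x2 - p"
  define D where "D = \<bar>Im (e1 * cnj e2)\<bar>"
  assume "Im ((x1 - p) * cnj (x2 - p)) \<noteq> 0"
  then have D: "0 < D" by (simp add: D_def e1_def e2_def)
  have e: "e1 \<noteq> 0" "e2 \<noteq> 0" using D by (auto simp: D_def)
  then have n: "0 < cmod e1" "0 < cmod e2" by auto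
  \<comment> \<open>\<open>t\<close> is the absolute sine of the angle between \<open>e1\<close> and \<open>e2\<close>.\<close>
  define t where "t = D / (cmod e1 * cmod e2)"
  define s where "s = t / 4"
  have s0: "0 < s" using D n by (simp add: s_def t_def)
  have "D \<le> cmod (e1 * cnj e2)" unfolding D_def by (rule abs_Im_le_cmod)
  then have "D \<le> cmod e1 * cmod e2" by (simp only: norm_mult complex_mod_cnj)
  then have "t \<le> 1" using n by (simp add: t_def pos_divide_le_eq)
  then have s1: "s \<le> 1" by (simp add: s_def)
  have "\<kappa> * s \<le> 1 * 1" using s0 s1 \<kappa>_le_1 \<kappa> by (intro mult_mono) auto
  then have \<kappa>s: "\<kappa> * s < pi" using pi_gt3 by linarith
  have s2: "2 * s * (2 * cmod e1 * cmod e2) \<le> \<bar>Im (e1 * cnj e2)\<bar>"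
    using n by (simp add: s_def t_def D_def)
  define m where "m = min (cmod e1) (cmod e2)"
  define R0 where "R0 = max (cmod e1) (cmod e2)"
  define c where "c = sin (\<kappa> * s) * \<kappa> * s * m"
  have sk: "0 < sin (\<kappa> * s) * \<kappa> * s"
    using s0 \<kappa>s \<kappa> by (intro mult_pos_pos sin_gt_zero) auto
  have c: "0 < c" unfolding c_def using n by (intro mult_pos_pos[OF sk]) (simp add: m_def)
  define G1 G2 where "G1 y = monotone_gap \<Omega> (p - y) e1" and "G2 y = monotone_gap \<Omega> (p - y) e2" for y
  have G: "0 \<le> G1 y" "0 \<le> G2 y" for y
    unfolding G1_def G2_def using monotone_gap_nonneg e by auto
  have [measurable]: "G1 \<in> borel_measurable borel" "G2 \<in> borel_measurable borel"
    unfolding G1_def[abs_def] G2_def[abs_def] by measurable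
  have lower: "c / dist p y \<le> G1 y + G2 y" if y: "R0 \<le> dist p y" for y
  proof -
    define v where "v = p - y"
    have v: "dist p y = cmod v" by (simp add: v_def dist_norm)
    have v1: "cmod e1 \<le> cmod v" and v2: "cmod e2 \<le> cmod v" using y by (auto simp: R0_def v)
    have each: "c / cmod v \<le> monotone_gap \<Omega> v e" if "e = e1 \<or> e = e2"
      "2 * s * (cmod v * cmod e) \<le> \<bar>Im (v * cnj e)\<bar>" for e
    proof -
      have e': "e \<noteq> 0" "cmod e \<le> cmod v" "m \<le> cmod e" using that(1) e v1 v2 by (auto simp: m_def)
      have "c / cmod v \<le> sin (\<kappa> * s) * \<kappa> * s * cmod e / cmod v"
        unfolding c_def using sk e'(3) by (intro divide_right_mono mult_left_mono) auto
      also have "\<dots> \<le> monotone_gap \<Omega> v e"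
        using e'(1) s0 \<kappa>s e'(2) that(2) by (rule monotone_gap_far)
      finally show ?thesis .
    qed
    from transversal_to_one[OF s2, of v] show ?thesis
    proof
      assume "2 * s * (cmod v * cmod e1) \<le> \<bar>Im (v * cnj e1)\<bar>"
      then show ?thesis using each[of e1] G(2)[of y] unfolding G1_def v v_def[symmetric] by simp
    next
      assume "2 * s * (cmod v * cmod e2) \<le> \<bar>Im (v * cnj e2)\<bar>"
      then show ?thesis using each[of e2] G(1)[of y] unfolding G2_def v v_def[symmetric] by simp
    qed
  qed
  have upper: "(\<integral>\<^sup>+y. ennreal (G1 y + G2 y) * indicator (ball p R) y \<partial>\<mu>)
      \<le> ennreal (4 * C * cmod e1 + 4 * C * cmod e2)" if R: "R0 \<le> R" for R
  proof -
    have "cmod e1 \<le> R" "cmod e2 \<le> R" using R by (simp_all add: R0_def)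
    then have "cmod e1 \<le> 2 * R" "cmod e2 \<le> 2 * R" using n by linarith+
    then have L: "dist x1 p \<le> 2 * R" "dist x2 p \<le> 2 * R" "x1 \<noteq> p" "x2 \<noteq> p"
      using e unfolding e1_def e2_def dist_norm by auto
    have "(\<integral>\<^sup>+y. ennreal (G1 y + G2 y) * indicator (ball p R) y \<partial>\<mu>) =
        (\<integral>\<^sup>+y. ennreal (G1 y) * indicator (ball p R) y + ennreal (G2 y) * indicator (ball p R) y \<partial>\<mu>)"
      using G by (intro nn_integral_cong) (simp add: distrib_right)
    also have "\<dots> = (\<integral>\<^sup>+y. ennreal (G1 y) * indicator (ball p R) y \<partial>\<mu>)
                 + (\<integral>\<^sup>+y. ennreal (G2 y) * indicator (ball p R) y \<partial>\<mu>)"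
      by (intro nn_integral_add) measurable
    also have "\<dots> \<le> ennreal (4 * C * cmod e1) + ennreal (4 * C * cmod e2)"
      using monotone_gap_integral_bound[OF x1 p L(3) L(1)] monotone_gap_integral_bound[OF x2 p L(4) L(2)]
      unfolding G1_def G2_def e1_def e2_def dist_norm by (intro add_mono) simp_all
    also have "\<dots> = ennreal (4 * C * cmod e1 + 4 * C * cmod e2)" using C by simp
    finally show ?thesis .
  qed
  have R0: "0 < R0" using n by (simp add: R0_def less_max_iff_disj)
  show False
    by (rule log_divergence[OF p R0 c lower _ upper]) measurable
qed

end

text \<open>Regularity excludes a support consisting of one point; a second point fixes the direction, and every
other point is collinear with these two.\<close>

lemma (in symmetric_regular) spt_in_line:
  obtains p e where "p \<in> spt \<mu>" "cmod e = 1" "\<And>x. x \<in> spt \<mu> \<Longrightarrow> \<exists>t::real. x = p + of_real t * e"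
proof -
  obtain p where p: "p \<in> spt \<mu>" using spt_nonempty by blast
  obtain x1 where x1: "x1 \<in> spt \<mu>" "x1 \<noteq> p" using spt_no_isolated_points[OF p zero_less_one] by blast
  define e where "e = sgn (x1 - p)"
  have e: "cmod e = 1" using x1 by (simp add: e_def norm_sgn)
  have "\<exists>t::real. x = p + of_real t * e" if x: "x \<in> spt \<mu>" for x
  proof -
    define w where "w = (x - p) * cnj e"
    have "cnj e = of_real (inverse (cmod (x1 - p))) * cnj (x1 - p)"
      by (simp add: e_def sgn_div_norm scaleR_conv_of_real)
    then have "w = of_real (inverse (cmod (x1 - p))) * ((x - p) * cnj (x1 - p))"
      by (simp add: w_def mult_ac)
    then have "Im w = inverse (cmod (x1 - p)) * Im ((x - p) * cnj (x1 - p))"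
      by (simp only: Im_complex_of_real Re_complex_of_real times_complex.sel(2) mult_zero_left add_0_right)
    also have "\<dots> = 0" using spt_collinear[OF p x x1(1)] by simp
    finally have "w = of_real (Re w)" by (simp add: complex_eq_iff)
    moreover have "w * e = x - p"
      using e by (simp add: w_def mult.assoc mult.commute[of "cnj e"] flip: complex_norm_square)
    ultimately have "x = p + of_real (Re w) * e" by (metis add.commute diff_add_cancel)
    then show ?thesis by blast
  qed
  then show ?thesis using that p e by blast
qed


section \<open>Measures on the line with arbitrarily small periods\<close>

text \<open>Let \<open>\<tau>\<close> be a small period and \<open>k\<close> the mass of \<open>(0, \<tau>]\<close>. Every half-open interval of length \<open>\<tau>\<close> has
mass \<open>k\<close>, so an interval of length \<open>h\<close> has mass \<open>h k / \<tau>\<close> up to an error \<open>k\<close>. Taking \<open>h = 1\<close>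
identifies \<open>k / \<tau>\<close> with \<open>c = N (0, 1]\<close> up to \<open>k\<close>, and \<open>k = O(\<tau> c)\<close> tends to \<open>0\<close> with \<open>\<tau>\<close>.\<close>

lemma small_periods_imp_lborel_multiple:
  fixes N :: "real measure"
  assumes sets: "sets N = sets borel" and fin: "\<And>a b. emeasure N {a..b} < \<infinity>"
    and nonzero: "emeasure N UNIV \<noteq> 0"
    and periods: "\<And>\<epsilon>. \<epsilon> > 0 \<Longrightarrow> \<exists>\<tau>. 0 < \<tau> \<and> \<tau> < \<epsilon> \<and>
                    (\<forall>B\<in>sets borel. emeasure N ((\<lambda>u. u + \<tau>) -` B) = emeasure N B)"
  obtains c where "c > 0" "\<And>B. B \<in> sets borel \<Longrightarrow> emeasure N B = ennreal c * emeasure lborel B"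
proof -
  define m where "m a b = measure N {a<..b}" for a b
  have fin': "emeasure N {a<..b} < \<infinity>" for a b
    using fin[of a b] emeasure_mono[of "{a<..b}" "{a..b}" N] by (simp add: sets subset_eq le_less_trans)
  have em: "emeasure N {a<..b} = ennreal (m a b)" for a b
    unfolding m_def using fin'[of a b] by (intro emeasure_eq_ennreal_measure) simp
  have m0: "0 \<le> m a b" for a b by (simp add: m_def)
  have split: "m a b + m b c = m a c" if "a \<le> b" "b \<le> c" for a b c
  proof -
    have "emeasure N {a<..b} + emeasure N {b<..c} = emeasure N ({a<..b} \<union> {b<..c})"
      by (intro plus_emeasure) (auto simp: sets)
    also have "{a<..b} \<union> {b<..c} = {a<..c}" using that by auto
    finally show ?thesis using m0 by (simp add: em flip: ennreal_plus)
  qed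
  define c where "c = m 0 1"
  have approx: "\<bar>m x y - (y - x) * c\<bar> \<le> (1 + (y - x)) * (2 * \<epsilon> * c)"
    if xy: "x \<le> y" and \<epsilon>: "0 < \<epsilon>" "\<epsilon> \<le> 1 / 2" for x y \<epsilon>
  proof -
    obtain \<tau> where \<tau>: "0 < \<tau>" "\<tau> < \<epsilon>"
      and per: "\<And>B. B \<in> sets borel \<Longrightarrow> emeasure N ((\<lambda>u. u + \<tau>) -` B) = emeasure N B"
      using periods[OF \<epsilon>(1)] by blast
    have shift: "m (a + \<tau>) (b + \<tau>) = m a b" for a b
    proof -
      have "(\<lambda>u. u + \<tau>) -` {a + \<tau><..b + \<tau>} = {a<..b}" by auto
      then show ?thesis using per[of "{a + \<tau><..b + \<tau>}"] by (simp add: m_def measure_def)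
    qed
    define k where "k = m 0 \<tau>"
    \<comment> \<open>The shifted interval \<open>(a, a + \<tau>]\<close> is compared with \<open>(0, \<tau>]\<close> by splitting the interval they span in two ways.\<close>
    have one: "m a (a + \<tau>) = k" for a
    proof (cases "0 \<le> a")
      case True
      have "m 0 a + m a (a + \<tau>) = m 0 \<tau> + m \<tau> (a + \<tau>)"
        using True \<tau> by (simp add: split)
      then show ?thesis using shift[of 0 a] by (simp add: k_def)
    next
      case False
      have "m a (a + \<tau>) + m (a + \<tau>) \<tau> = m a 0 + m 0 \<tau>"
        using False \<tau> by (simp add: split)
      then show ?thesis using shift[of a 0] by (simp add: k_def)
    qed
    have many: "m a (a + real n * \<tau>) = real n * k" for a n
    proof (induction n)
      case (Suc n)
      have "m a (a + real n * \<tau>) + m (a + real n * \<tau>) (a + real n * \<tau> + \<tau>) = m a (a + real n * \<tau> + \<tau>)"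
        using \<tau> by (intro split) auto
      then show ?case using Suc one[of "a + real n * \<tau>"] by (simp add: algebra_simps)
    qed (simp add: m_def)
    have k0: "0 \<le> k" by (simp add: k_def m0)
    have key: "\<exists>n::nat. real n \<le> h / \<tau> \<and> h / \<tau> < real n + 1 \<and> real n * k \<le> m a (a + h) \<and> m a (a + h) \<le> (real n + 1) * k"
      if h: "0 \<le> h" for a h
    proof (intro exI conjI)
      define n where "n = nat \<lfloor>h / \<tau>\<rfloor>"
      have q0: "0 \<le> h / \<tau>" using h \<tau> by simp
      show n1: "real n \<le> h / \<tau>" and n2: "h / \<tau> < real n + 1" unfolding n_def using q0 by linarith+
      have le: "real n * \<tau> \<le> h" "h \<le> (real n + 1) * \<tau>"
        using n1 n2 \<tau> by (simp_all add: pos_le_divide_eq pos_divide_less_eq)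
      have "m a (a + real n * \<tau>) + m (a + real n * \<tau>) (a + h) = m a (a + h)"
        using le \<tau> by (intro split) auto
      then show "real n * k \<le> m a (a + h)" using many m0 by (metis le_add_same_cancel1)
      have "m a (a + h) + m (a + h) (a + real (n + 1) * \<tau>) = m a (a + real (n + 1) * \<tau>)"
        using le h by (intro split) (auto simp: add.commute)
      then have "m a (a + h) \<le> m a (a + real (n + 1) * \<tau>)" using m0[of "a + h" "a + real (n + 1) * \<tau>"] by linarith
      also have "\<dots> = real (n + 1) * k" by (rule many)
      finally show "m a (a + h) \<le> (real n + 1) * k" by (simp add: add.commute)
    qed
    have dev: "\<bar>m a (a + h) - (h / \<tau>) * k\<bar> \<le> k" if h: "0 \<le> h" for a h
    proof -
      obtain n :: nat where n: "real n \<le> h / \<tau>" "h / \<tau> < real n + 1"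
        "real n * k \<le> m a (a + h)" "m a (a + h) \<le> (real n + 1) * k"
        using key[OF h] by blast
      have "real n * k \<le> (h / \<tau>) * k" "(h / \<tau>) * k \<le> (real n + 1) * k"
        using n k0 by (intro mult_right_mono; simp)+
      then show ?thesis using n by (simp add: abs_le_iff distrib_right)
    qed
    have "k \<le> 2 * \<tau> * c"
    proof -
      obtain n :: nat where n: "1 / \<tau> < real n + 1" "real n * k \<le> c"
        using key[of 1 0] by (auto simp: c_def)
      have "1 < (real n + 1) * \<tau>" using n \<tau> by (simp add: pos_divide_less_eq)
      then have "1 \<le> 2 * \<tau> * real n" using \<tau> \<epsilon> by (simp add: algebra_simps)
      then have "1 * k \<le> 2 * \<tau> * real n * k" using k0 by (intro mult_right_mono)
      also have "\<dots> \<le> 2 * \<tau> * c" using n(2) \<tau> by (simp add: mult.assoc)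
      finally show ?thesis by simp
    qed
    also have "2 * \<tau> * c \<le> 2 * \<epsilon> * c" using \<tau> m0 by (intro mult_right_mono) (auto simp: c_def)
    finally have k: "k \<le> 2 * \<epsilon> * c" .
    define h where "h = y - x"
    have h: "0 \<le> h" using xy by (simp add: h_def)
    have "\<bar>m x y - (h / \<tau>) * k\<bar> \<le> k" using dev[OF h, of x] by (simp add: h_def)
    moreover have "\<bar>h * (c - 1 / \<tau> * k)\<bar> \<le> h * k"
      using dev[of 1 0] h mult_left_mono[of "\<bar>c - 1 / \<tau> * k\<bar>" k h]
      by (simp add: c_def abs_mult)
    then have "\<bar>h * c - h * (1 / \<tau> * k)\<bar> \<le> h * k" by (simp only: right_diff_distrib)
    moreover have "h * (1 / \<tau> * k) = (h / \<tau>) * k" by simp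
    ultimately have "\<bar>m x y - h * c\<bar> \<le> k + h * k" by linarith
    also have "\<dots> = (1 + h) * k" by (simp add: algebra_simps)
    also have "\<dots> \<le> (1 + h) * (2 * \<epsilon> * c)" using k h by (intro mult_left_mono) auto
    finally show ?thesis by (simp add: h_def)
  qed
  have c0: "0 \<le> c" by (simp add: c_def m0)
  have m_eq: "m x y = (y - x) * c" if xy: "x \<le> y" for x y
  proof -
    define K where "K = (1 + (y - x)) * (2 * c)"
    have K: "0 \<le> K" using xy c0 by (simp add: K_def)
    have "\<bar>m x y - (y - x) * c\<bar> \<le> 0 + \<eta>" if \<eta>: "0 < \<eta>" for \<eta>
    proof -
      define \<epsilon> where "\<epsilon> = min (1 / 2) (\<eta> / (K + 1))"
      have \<epsilon>: "0 < \<epsilon>" using \<eta> K by (simp add: \<epsilon>_def)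
      have \<epsilon>': "\<epsilon> \<le> 1 / 2" unfolding \<epsilon>_def by (rule min.cobounded1)
      have "\<epsilon> * K \<le> \<eta> / (K + 1) * (K + 1)" using \<eta> K by (intro mult_mono) (auto simp: \<epsilon>_def)
      then have "\<epsilon> * K \<le> \<eta>" using K by simp
      moreover have "(1 + (y - x)) * (2 * \<epsilon> * c) = \<epsilon> * K" by (simp add: K_def)
      ultimately show ?thesis using approx[OF xy \<epsilon> \<epsilon>'] by linarith
    qed
    then have "\<bar>m x y - (y - x) * c\<bar> \<le> 0" by (rule field_le_epsilon)
    then show ?thesis by simp
  qed
  have "c \<noteq> 0"
  proof
    assume "c = 0"
    then have "{- real n<..real n} \<in> null_sets N" for n
      using em[of "- real n" "real n"] m_eq[of "- real n" "real n"] by (simp add: null_sets_def sets)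
    then have "(\<Union>n. {- real n<..real n}) \<in> null_sets N" by (rule null_sets_UN)
    moreover have "(\<Union>n. {- real n<..real n}) = UNIV"
    proof -
      have "\<exists>n. - real n < x \<and> x \<le> real n" for x
      proof -
        obtain n where "\<bar>x\<bar> < real n" using reals_Archimedean2 by blast
        then have "- real n < x \<and> x \<le> real n" by linarith
        then show ?thesis by blast
      qed
      then show ?thesis by auto
    qed
    ultimately show False using nonzero by (simp add: null_sets_def)
  qed
  then have c: "0 < c" using c0 by simp
  have point: "emeasure N {b} = 0" for b
  proof -
    have "emeasure N {b} \<le> 0 + ennreal \<eta>" if "0 < \<eta>" for \<eta>
    proof -
      have "emeasure N {b} \<le> emeasure N {b - \<eta> / c<..b}"
        using that c by (intro emeasure_mono) (auto simp: sets)
      also have "\<dots> = ennreal \<eta>" using that c by (simp add: em m_eq)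
      finally show ?thesis by simp
    qed
    then have "emeasure N {b} \<le> 0" by (rule ennreal_le_epsilon)
    then show ?thesis by simp
  qed
  have "lborel = scale_measure (ennreal (1 / c)) N"
  proof (rule lborel_eqI)
    fix l u :: real assume "\<And>b. b \<in> Basis \<Longrightarrow> l \<bullet> b \<le> u \<bullet> b"
    then have lu: "l \<le> u" by simp
    have "emeasure N {l<..<u} = emeasure N {l<..u}"
    proof (cases "l = u")
      case False
      have "emeasure N {l<..u} = emeasure N ({l<..<u} \<union> {u})"
        using lu False by (intro arg_cong[where f = "emeasure N"]) auto
      also have "\<dots> = emeasure N {l<..<u} + emeasure N {u}"
        by (intro plus_emeasure[symmetric]) (auto simp: sets)
      finally show ?thesis by (simp add: point)
    qed simp
    then show "emeasure (scale_measure (ennreal (1 / c)) N) (box l u) = (\<Prod>b\<in>Basis. (u - l) \<bullet> b)"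
      using lu c by (simp add: em m_eq box_real flip: ennreal_mult)
  qed (simp add: sets)
  then have "emeasure lborel B = ennreal (1 / c) * emeasure N B" for B
    by (metis emeasure_scale_measure)
  note scaled = this
  have "emeasure N B = ennreal c * emeasure lborel B" for B
  proof -
    have "ennreal c * ennreal (1 / c) = 1" using c by (simp flip: ennreal_mult)
    then show ?thesis unfolding scaled by (simp flip: mult.assoc)
  qed
  then show ?thesis using c that by blast
qed

section \<open>Hausdorff measure on isometric copies of the line\<close>

lemma diameter_le_of_dist_le:
  fixes S :: "'a::metric_space set"
  assumes "0 \<le> d" "\<And>x y. x \<in> S \<Longrightarrow> y \<in> S \<Longrightarrow> dist x y \<le> d"
  shows "diameter S \<le> d"
proof (cases "S = {}")
  case False
  then have "(SUP (x, y)\<in>S \<times> S. dist x y) \<le> d"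
    by (intro cSUP_least) (auto intro: assms)
  then show ?thesis using False by (simp add: diameter_def)
qed (use assms in \<open>simp add: diameter_def\<close>)

lemma real_set_subset_interval:
  fixes V :: "real set"
  assumes d: "0 \<le> d" and close: "\<And>s t. s \<in> V \<Longrightarrow> t \<in> V \<Longrightarrow> \<bar>s - t\<bar> \<le> d"
  obtains a where "V \<subseteq> {a..a + d}"
proof (cases "V = {}")
  case True then show ?thesis using that by auto
next
  case False
  have bdd: "bdd_below V"
  proof -
    obtain s where "s \<in> V" using False by blast
    then have "s - d \<le> t" if "t \<in> V" for t using close[OF _ that, of s] by (simp add: abs_le_iff)
    then show ?thesis by (meson bdd_below.I)
  qed
  have "s \<le> Inf V + d" if "s \<in> V" for s
  proof -
    have "s - d \<le> Inf V" using False close[OF that] by (intro cInf_greatest) (auto simp: abs_le_iff algebra_simps)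
    then show ?thesis by simp
  qed
  then have "V \<subseteq> {Inf V..Inf V + d}" using cInf_lower[OF _ bdd] by auto
  then show ?thesis by (rule that)
qed

text \<open>A bounded set meets the image of the line in the image of a set contained in an interval of length
its diameter, so any cover gives a cover by intervals with the same sum of lengths.\<close>

lemma emeasure_lborel_le_cover:
  fixes q :: "real \<Rightarrow> 'a::metric_space"
  assumes iso: "\<And>s t. dist (q s) (q t) = \<bar>s - t\<bar>" and B: "B \<in> sets borel"
    and cover: "q ` B \<subseteq> (\<Union>i. U i)" and bounded: "\<And>i::nat. bounded (U i)"
  shows "emeasure lborel B \<le> (\<Sum>i. ennreal (diameter (U i)))"
proof -
  have "\<forall>i. \<exists>a. q -` U i \<subseteq> {a..a + diameter (U i)}"
  proof
    fix i
    show "\<exists>a. q -` U i \<subseteq> {a..a + diameter (U i)}"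
    proof (rule real_set_subset_interval[of "diameter (U i)" "q -` U i"])
      show "0 \<le> diameter (U i)" using bounded by (rule diameter_ge_0)
      show "\<bar>s - t\<bar> \<le> diameter (U i)" if "s \<in> q -` U i" "t \<in> q -` U i" for s t
        using diameter_bounded_bound[OF bounded, of "q s" i "q t"] that by (simp add: iso)
    qed blast
  qed
  then have "\<exists>a. \<forall>i. q -` U i \<subseteq> {a i..a i + diameter (U i)}" by (rule choice)
  then obtain a where a: "\<And>i. q -` U i \<subseteq> {a i..a i + diameter (U i)}" by blast
  have "B \<subseteq> (\<Union>i. {a i..a i + diameter (U i)})"
  proof
    fix t assume "t \<in> B"
    then obtain i where "t \<in> q -` U i" using cover by blast
    then show "t \<in> (\<Union>i. {a i..a i + diameter (U i)})" using a by blast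
  qed
  then have "emeasure lborel B \<le> emeasure lborel (\<Union>i. {a i..a i + diameter (U i)})"
    by (intro emeasure_mono) auto
  also have "\<dots> \<le> (\<Sum>i. emeasure lborel {a i..a i + diameter (U i)})"
    by (intro emeasure_subadditive_countably) auto
  also have "\<dots> = (\<Sum>i. ennreal (diameter (U i)))"
    using diameter_ge_0[OF bounded] by simp
  finally show ?thesis .
qed

text \<open>Enclose \<open>B\<close> in an open set \<open>V\<close> of nearly the same measure and cut \<open>V\<close> at the grid of multiples of
\<open>\<epsilon>\<close>. The components of what remains are disjoint intervals no longer than \<open>\<epsilon>\<close>, so their
diameters add up to at most the measure of \<open>V\<close>; the grid points are covered by
singletons, of diameter \<open>0\<close>.\<close>

lemma hausdorff1_pre_le_emeasure_lborel:
  fixes q :: "real \<Rightarrow> 'a::metric_space"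
  assumes iso: "\<And>s t. dist (q s) (q t) = \<bar>s - t\<bar>" and B: "B \<in> sets borel" and \<epsilon>: "0 < \<epsilon>"
  shows "hausdorff1_pre \<epsilon> (q ` B) \<le> emeasure lborel B"
proof (rule ennreal_le_epsilon)
  fix \<eta> :: real assume "0 < \<eta>"
  then obtain V where V: "open V" "B \<subseteq> V" "emeasure lborel (V - B) < ennreal \<eta>"
    using outer_regular_lborel[OF B] by metis
  define grid where "grid = range (\<lambda>k::int. \<epsilon> * of_int k)"
  have "closed ((*\<^sub>R) \<epsilon> ` range real_of_int)" by (intro closed_scaling closed_of_int_image)
  then have closed: "closed grid" by (simp add: grid_def image_image)
  define W where "W = V - grid"
  have W: "open W" unfolding W_def using V(1) closed by (rule open_Diff)
  define F where "F = components W \<union> (\<lambda>g. {g}) ` grid"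
  have "countable (components W)" 
  proof (rule countable_disjoint_open_subsets)
    show "open S" if "S \<in> components W" for S using W that by (rule open_components)
    show "pairwise disjnt (components W)"
      using pairwise_disjoint_components by (simp add: pairwise_def disjnt_def)
  qed
  then have count: "countable F" by (simp add: F_def grid_def)
  have "inj (\<lambda>k::int. \<epsilon> * of_int k)" using \<epsilon> by (simp add: inj_def)
  \<comment> \<open>The grid singletons make the cover infinite, so it can be enumerated without repetition.\<close>
  then have "infinite grid" unfolding grid_def using finite_imageD infinite_UNIV_int by blast
  then have "infinite ((\<lambda>g. {g}) ` grid)" by (subst finite_image_iff) (auto simp: inj_on_def)
  then have inf: "infinite F" by (simp add: F_def)
  define f where "f = from_nat_into F"
  have bij: "bij_betw f UNIV F" unfolding f_def using count inf by (rule bij_betw_from_nat_into)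
  have fF: "f i \<in> F" for i using bij by (auto simp: bij_betw_def)
  have conn: "connected S" "S \<in> sets borel" if "S \<in> F" for S
    using that W by (auto simp: F_def in_components_connected intro: borel_open open_components)
  have small: "\<bar>s - t\<bar> \<le> \<epsilon>" if S: "S \<in> F" "s \<in> S" "t \<in> S" for S s t
  proof (cases "S \<in> components W")
    case False then show ?thesis using S \<epsilon> by (auto simp: F_def)
  next
    case True
    have "t' - s' \<le> \<epsilon>" if st: "s' \<in> S" "t' \<in> S" for s' t'
    proof (rule ccontr)
      assume big: "\<not> t' - s' \<le> \<epsilon>"
      define k where "k = \<lceil>s' / \<epsilon>\<rceil>"
      define g where "g = \<epsilon> * of_int k"
      have "s' / \<epsilon> \<le> of_int k" "of_int k \<le> s' / \<epsilon> + 1" unfolding k_def by linarith+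
      then have "s' \<le> g" "g \<le> s' + \<epsilon>" using \<epsilon> by (simp_all add: g_def field_simps)
      then have "g \<in> {s'..t'}" using big by auto
      then have "g \<in> S" using connected_contains_Icc[OF conn(1)[OF S(1)] st] by blast
      then have "g \<in> W" using True in_components_subset by blast
      then show False by (auto simp: W_def grid_def g_def)
    qed
    then show ?thesis using S(2,3) by (simp add: abs_le_iff)
  qed
  have diam: "ennreal (diameter (q ` S)) \<le> emeasure lborel S" if S: "S \<in> F" for S
  proof -
    obtain a where "S \<subseteq> {a..a + \<epsilon>}"
      using real_set_subset_interval[of \<epsilon> S] small[OF S] \<epsilon> by (metis less_imp_le)
    then have "emeasure lborel S \<le> emeasure lborel {a..a + \<epsilon>}" by (intro emeasure_mono) auto
    then have fin: "emeasure lborel S < \<infinity>" using \<epsilon> by (simp add: le_less_trans)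
    have le: "t - s \<le> measure lborel S" if st: "s \<in> S" "t \<in> S" "s \<le> t" for s t
    proof -
      have "{s..t} \<subseteq> S" using connected_contains_Icc[OF conn(1)[OF S]] st by blast
      then have "emeasure lborel {s..t} \<le> emeasure lborel S"
        using conn(2)[OF S] by (intro emeasure_mono) auto
      then have "ennreal (t - s) \<le> ennreal (measure lborel S)"
        using st fin by (simp add: emeasure_eq_ennreal_measure)
      then show ?thesis by (simp add: ennreal_le_iff)
    qed
    have "diameter (q ` S) \<le> measure lborel S"
    proof (rule diameter_le_of_dist_le)
      fix x y assume "x \<in> q ` S" "y \<in> q ` S"
      then obtain s t where "x = q s" "y = q t" "s \<in> S" "t \<in> S" by blast
      then show "dist x y \<le> measure lborel S"
        using le[of s t] le[of t s] by (cases "s \<le> t") (auto simp: iso)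
    qed simp
    then show ?thesis using fin by (simp add: emeasure_eq_ennreal_measure ennreal_leI)
  qed
  have disj: "disjoint_family f"
  proof (unfold disjoint_family_on_def, intro ballI impI)
    fix i j :: nat assume "i \<noteq> j"
    then have "f i \<noteq> f j" using bij by (auto simp: bij_betw_def inj_on_def)
    moreover have "S \<inter> T = {}" if "S \<in> F" "T \<in> F" "S \<noteq> T" for S T
    proof -
      have "S \<inter> T = {}" if "S \<in> components W" "T \<in> components W" "S \<noteq> T" for S T
        using that components_nonoverlap by blast
      moreover have "g \<notin> S" if "S \<in> components W" "g \<in> grid" for g S
        using that in_components_subset[of S W] by (auto simp: W_def)
      ultimately show ?thesis using that by (auto simp: F_def)
    qed
    ultimately show "f i \<inter> f j = {}" using fF by blast
  qed
  have UnF: "(\<Union>i. f i) = W \<union> grid"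
  proof -
    have "(\<Union>i. f i) = \<Union>F" using bij by (auto simp: bij_betw_def)
    also have "\<dots> = W \<union> grid" unfolding F_def Union_Un_distrib Union_components by auto
    finally show ?thesis .
  qed
  have cover: "q ` B \<subseteq> (\<Union>i. q ` f i)"
  proof -
    have "B \<subseteq> (\<Union>i. f i)" unfolding UnF W_def using V(2) by blast
    then show ?thesis by blast
  qed
  have "(\<lambda>i. q ` f i) \<in> {U. q ` B \<subseteq> (\<Union>i. U i) \<and> (\<forall>i. bounded (U i) \<and> diameter (U i) \<le> \<epsilon>)}"
  proof (intro CollectI conjI allI cover)
    fix i
    have "dist x y \<le> \<epsilon>" if "x \<in> q ` f i" "y \<in> q ` f i" for x y
      using that small[OF fF[of i]] by (auto simp: iso)
    then show "bounded (q ` f i)" "diameter (q ` f i) \<le> \<epsilon>"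
      using \<epsilon> by (auto intro!: diameter_le_of_dist_le simp: bounded_two_points)
  qed
  then have "hausdorff1_pre \<epsilon> (q ` B) \<le> (\<Sum>i. ennreal (diameter (q ` f i)))"
    unfolding hausdorff1_pre_def by (rule INF_lower)
  also have "\<dots> \<le> (\<Sum>i. emeasure lborel (f i))" using diam fF by (intro suminf_le) auto
  also have "\<dots> = emeasure lborel (W \<union> grid)"
    using suminf_emeasure[of f lborel] disj conn(2) fF by (simp add: UnF image_subset_iff)
  also have "\<dots> \<le> emeasure lborel W + emeasure lborel grid"
    using W closed by (intro emeasure_subadditive) auto
  also have "emeasure lborel grid = 0"
    unfolding grid_def by (intro emeasure_lborel_countable) simp
  also have "emeasure lborel W + 0 \<le> emeasure lborel V"
    using V(1) by (simp add: W_def) (intro emeasure_mono, auto)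
  also have "\<dots> = emeasure lborel (B \<union> (V - B))" using V(2) by (simp add: Un_absorb1)
  also have "\<dots> \<le> emeasure lborel B + emeasure lborel (V - B)"
    using V(1) B by (intro emeasure_subadditive) auto
  also have "\<dots> \<le> emeasure lborel B + ennreal \<eta>" using V(3) by (intro add_left_mono) simp
  finally show "hausdorff1_pre \<epsilon> (q ` B) \<le> emeasure lborel B + ennreal \<eta>" .
qed

theorem hausdorff1_isometric_image:
  fixes q :: "real \<Rightarrow> 'a::metric_space"
  assumes iso: "\<And>s t. dist (q s) (q t) = \<bar>s - t\<bar>" and B: "B \<in> sets borel"
  shows "hausdorff1 (q ` B) = emeasure lborel B"
proof (rule antisym)
  show "hausdorff1 (q ` B) \<le> emeasure lborel B"
    unfolding hausdorff1_def
    using hausdorff1_pre_le_emeasure_lborel[OF iso B] by (intro SUP_least) simp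
  have "emeasure lborel B \<le> hausdorff1_pre 1 (q ` B)"
    unfolding hausdorff1_pre_def
    using emeasure_lborel_le_cover[OF iso B] by (intro INF_greatest) blast
  also have "\<dots> \<le> hausdorff1 (q ` B)" unfolding hausdorff1_def by (intro SUP_upper) simp
  finally show "emeasure lborel B \<le> hausdorff1 (q ` B)" .
qed

section \<open>Symmetric measures carried by a line\<close>

locale symmetric_regular_line = symmetric_regular +
  fixes p e :: complex
  assumes p_in_spt: "p \<in> spt \<mu>" and unit: "cmod e = 1"
    and in_line: "\<And>x. x \<in> spt \<mu> \<Longrightarrow> \<exists>t::real. x = p + of_real t * e"
begin

definition param :: "real \<Rightarrow> complex" where
  "param t = p + of_real t * e"

definition coord :: "complex \<Rightarrow> real" where
  "coord z = Re ((z - p) * cnj e)"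

definition \<nu> :: "real measure" where
  "\<nu> = distr \<mu> borel coord"

lemma coord_param [simp]: "coord (param t) = t"
proof -
  have "(param t - p) * cnj e = of_real t * (e * cnj e)" by (simp add: param_def)
  also have "\<dots> = of_real t" using unit by (simp flip: complex_norm_square)
  finally show ?thesis by (simp add: coord_def)
qed

lemma dist_param: "dist (param s) (param t) = \<bar>s - t\<bar>"
proof -
  have "param s - param t = of_real (s - t) * e" by (simp add: param_def algebra_simps)
  then show ?thesis using unit by (simp add: dist_norm norm_mult del: of_real_diff)
qed

lemma param_measurable [measurable]: "param \<in> borel_measurable borel"
  unfolding param_def[abs_def] by measurable

lemma coord_measurable [measurable]: "coord \<in> borel_measurable borel"
  unfolding coord_def[abs_def] by measurable

lemma sets_\<nu> [measurable_cong]: "sets \<nu> = sets borel"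
  by (simp add: \<nu>_def)

text \<open>Almost every point lies in the support, hence on the line, where \<open>param\<close> inverts \<open>coord\<close>.\<close>

lemma nn_integral_line:
  assumes [measurable]: "F \<in> borel_measurable borel"
  shows "(\<integral>\<^sup>+y. F y \<partial>\<mu>) = (\<integral>\<^sup>+t. F (param t) \<partial>\<nu>)"
proof -
  have "AE y in \<mu>. y \<in> spt \<mu>"
  proof (rule AE_I')
    show "- spt \<mu> \<in> null_sets \<mu>"
      using open_compl_spt[of \<mu>] emeasure_compl_spt[OF sets_mu] by (simp add: null_sets_def sets_mu)
  qed auto
  then have "AE y in \<mu>. F y = F (param (coord y))"
  proof (rule AE_mp, intro AE_I2 impI)
    fix y assume "y \<in> spt \<mu>"
    then obtain t where "y = param t" using in_line unfolding param_def by blast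
    then show "F y = F (param (coord y))" by simp
  qed
  then have "(\<integral>\<^sup>+y. F y \<partial>\<mu>) = (\<integral>\<^sup>+y. F (param (coord y)) \<partial>\<mu>)" by (rule nn_integral_cong_AE)
  also have "\<dots> = (\<integral>\<^sup>+t. F (param t) \<partial>\<nu>)"
    unfolding \<nu>_def by (intro nn_integral_distr[symmetric]) measurable
  finally show ?thesis .
qed

lemma emeasure_line:
  assumes A: "A \<in> sets borel"
  shows "emeasure \<mu> A = emeasure \<nu> (param -` A)"
proof -
  have A': "param -` A \<in> sets borel" using measurable_sets[OF param_measurable A] by simp
  have "emeasure \<mu> A = (\<integral>\<^sup>+y. indicator A y \<partial>\<mu>)" using A by (simp add: sets_mu)
  also have "\<dots> = (\<integral>\<^sup>+t. indicator A (param t) \<partial>\<nu>)" using A by (intro nn_integral_line) simp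
  also have "\<dots> = (\<integral>\<^sup>+t. indicator (param -` A) t \<partial>\<nu>)"
    by (intro nn_integral_cong) (simp add: indicator_def)
  also have "\<dots> = emeasure \<nu> (param -` A)" using A' by (simp add: sets_\<nu>)
  finally show ?thesis .
qed

text \<open>By oddness the kernel takes on the line the values \<open>kernel \<Omega> ((t0 - t) e) = (t0 - t) \<Omega> e\<close>, so in
the radial identity with weight \<open>1 / r\<close> on \<open>A\<close> the integrands are the indicators of the two sides.\<close>

lemma one_sided_reflection:
  assumes t0: "param t0 \<in> spt \<mu>" and A[measurable]: "A \<in> sets borel"
  shows "emeasure \<nu> {t. t < t0 \<and> t0 - t \<in> A} = emeasure \<nu> {t. t0 < t \<and> t - t0 \<in> A}"
proof -
  define c where "c = cnj (unit_kernel \<Omega> e)"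
  have c: "cmod c \<le> 1" using cmod_unit_kernel_le_1[OF map] by (simp add: c_def)
  define h :: "real \<Rightarrow> ennreal" where "h r = ennreal (1 / r) * indicator A r" for r
  have h[measurable]: "h \<in> borel_measurable borel" unfolding h_def by measurable
  have "e \<noteq> 0" using unit by auto
  then have "Re (unit_kernel \<Omega> e * c) = 1"
    using cmod_unit_kernel[OF map, of e] by (simp add: c_def flip: complex_norm_square)
  then have comp: "dist (param t0) (param t) * Re (unit_kernel \<Omega> (param t0 - param t) * c) = t0 - t" for t
  proof -
    have "param t0 - param t = of_real (t0 - t) * e" by (simp add: param_def algebra_simps)
    then have "unit_kernel \<Omega> (param t0 - param t) * c = of_real (sgn (t0 - t)) * (unit_kernel \<Omega> e * c)"
      by (simp only: unit_kernel_of_real_mult[OF odd] mult.assoc)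
    then have "Re (unit_kernel \<Omega> (param t0 - param t) * c) = sgn (t0 - t) * Re (unit_kernel \<Omega> e * c)"
      by (simp only: times_complex.sel Re_complex_of_real Im_complex_of_real mult_zero_left diff_zero)
    then have "Re (unit_kernel \<Omega> (param t0 - param t) * c) = sgn (t0 - t)"
      using \<open>Re (unit_kernel \<Omega> e * c) = 1\<close> by (simp only: mult_1_right)
    then show ?thesis by (simp only: dist_param abs_mult_sgn)
  qed
  define f where "f s y = ennreal (s * (dist (param t0) y * Re (unit_kernel \<Omega> (param t0 - y) * c))) * h (dist (param t0) y)" for s y
  have [measurable]: "f s \<in> borel_measurable borel" for s unfolding f_def by measurable
  have f: "f s (param t) = ennreal (s * (t0 - t)) * h \<bar>t0 - t\<bar>" for s t
    unfolding f_def comp unfolding dist_param ..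
  have "(\<integral>\<^sup>+y. f 1 y \<partial>\<mu>) = (\<integral>\<^sup>+y. f (-1) y \<partial>\<mu>)"
    using directional_balance[OF t0 c h] unfolding f_def by (simp only: mult_1 mult_minus1)
  then have "(\<integral>\<^sup>+t. f 1 (param t) \<partial>\<nu>) = (\<integral>\<^sup>+t. f (-1) (param t) \<partial>\<nu>)"
    by (simp add: nn_integral_line)
  also have "(\<integral>\<^sup>+t. f 1 (param t) \<partial>\<nu>) = (\<integral>\<^sup>+t. indicator {t. t < t0 \<and> t0 - t \<in> A} t \<partial>\<nu>)"
  proof (intro nn_integral_cong)
    fix t
    show "f 1 (param t) = indicator {t. t < t0 \<and> t0 - t \<in> A} t"
      by (cases "t < t0") (auto simp: f h_def indicator_def ennreal_neg simp flip: ennreal_mult)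
  qed
  also have "\<dots> = emeasure \<nu> {t. t < t0 \<and> t0 - t \<in> A}"
    by (intro nn_integral_indicator) measurable
  also have "(\<integral>\<^sup>+t. f (-1) (param t) \<partial>\<nu>) = (\<integral>\<^sup>+t. indicator {t. t0 < t \<and> t - t0 \<in> A} t \<partial>\<nu>)"
  proof (intro nn_integral_cong)
    fix t
    show "f (-1) (param t) = indicator {t. t0 < t \<and> t - t0 \<in> A} t"
      by (cases "t0 < t") (auto simp: f h_def indicator_def ennreal_neg simp flip: ennreal_mult)
  qed
  also have "\<dots> = emeasure \<nu> {t. t0 < t \<and> t - t0 \<in> A}"
    by (intro nn_integral_indicator) measurable
  finally show ?thesis .
qed

lemma reflection:
  assumes t0: "param t0 \<in> spt \<mu>" and B[measurable]: "B \<in> sets borel"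
  shows "emeasure \<nu> ((\<lambda>t. 2 * t0 - t) -` B) = emeasure \<nu> B"
proof -
  define B' where "B' = (\<lambda>t. 2 * t0 - t) -` B"
  have [measurable]: "B' \<in> sets borel"
    using measurable_sets[of "\<lambda>t. 2 * t0 - t" borel borel B] by (simp add: B'_def)
  have B': "t \<in> B' \<longleftrightarrow> 2 * t0 - t \<in> B" for t by (simp add: B'_def)
  have parts: "emeasure \<nu> S = emeasure \<nu> {t \<in> S. t < t0} + emeasure \<nu> {t \<in> S. t0 < t} + emeasure \<nu> {t \<in> S. t = t0}"
    if [measurable]: "S \<in> sets borel" for S
  proof -
    have ms: "{t \<in> S. t < t0} \<in> sets \<nu>" "{t \<in> S. t0 < t} \<in> sets \<nu>" "{t \<in> S. t = t0} \<in> sets \<nu>"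
      by measurable
    have "emeasure \<nu> {t \<in> S. t < t0} + emeasure \<nu> {t \<in> S. t0 < t} + emeasure \<nu> {t \<in> S. t = t0}
        = emeasure \<nu> ({t \<in> S. t < t0} \<union> {t \<in> S. t0 < t}) + emeasure \<nu> {t \<in> S. t = t0}"
      using ms by (subst plus_emeasure) auto
    also have "\<dots> = emeasure \<nu> ({t \<in> S. t < t0} \<union> {t \<in> S. t0 < t} \<union> {t \<in> S. t = t0})"
      using ms by (intro plus_emeasure) auto
    also have "{t \<in> S. t < t0} \<union> {t \<in> S. t0 < t} \<union> {t \<in> S. t = t0} = S" by auto
    finally show ?thesis by simp
  qed
  have swap: "emeasure \<nu> {t \<in> S. t < t0} = emeasure \<nu> {t \<in> S'. t0 < t}"
    if [measurable]: "S \<in> sets borel" and S': "\<And>t. t \<in> S' \<longleftrightarrow> 2 * t0 - t \<in> S" for S S'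
  proof -
    define A where "A = (\<lambda>r. t0 - r) -` S"
    have "A \<in> sets borel" using measurable_sets[of "\<lambda>r. t0 - r" borel borel S] by (simp add: A_def)
    note one_sided_reflection[OF t0 this]
    moreover have "{t. t < t0 \<and> t0 - t \<in> A} = {t \<in> S. t < t0}" by (auto simp: A_def)
    moreover have "{t. t0 < t \<and> t - t0 \<in> A} = {t \<in> S'. t0 < t}" by (auto simp: A_def S' algebra_simps)
    ultimately show ?thesis by simp
  qed
  have "{t \<in> B. t = t0} = {t \<in> B'. t = t0}" by (auto simp: B')
  moreover have "emeasure \<nu> {t \<in> B. t < t0} = emeasure \<nu> {t \<in> B'. t0 < t}" by (rule swap) (auto simp: B')
  moreover have "emeasure \<nu> {t \<in> B'. t < t0} = emeasure \<nu> {t \<in> B. t0 < t}" by (rule swap) (auto simp: B')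
  ultimately show ?thesis using parts[of B] parts[of B'] by (simp add: B'_def[symmetric] add_ac)
qed

text \<open>The composition of the reflections in two points is the translation by twice their difference.\<close>

lemma translation:
  assumes s: "param s \<in> spt \<mu>" and t: "param t \<in> spt \<mu>" and B: "B \<in> sets borel"
  shows "emeasure \<nu> ((\<lambda>u. u + 2 * (t - s)) -` B) = emeasure \<nu> B"
proof -
  define B' where "B' = (\<lambda>u. 2 * t - u) -` B"
  have "B' \<in> sets borel"
    using measurable_sets[OF _ B, of "\<lambda>u. 2 * t - u" borel] by (simp add: B'_def)
  then have "emeasure \<nu> ((\<lambda>u. 2 * s - u) -` B') = emeasure \<nu> B'" by (rule reflection[OF s])
  also have "\<dots> = emeasure \<nu> B" unfolding B'_def by (rule reflection[OF t B])
  also have "(\<lambda>u. 2 * s - u) -` B' = (\<lambda>u. u + 2 * (t - s)) -` B"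
    unfolding B'_def vimage_def by (simp add: algebra_simps)
  finally show ?thesis .
qed

lemma small_periods:
  assumes \<epsilon>: "\<epsilon> > 0"
  shows "\<exists>\<tau>. 0 < \<tau> \<and> \<tau> < \<epsilon> \<and> (\<forall>B\<in>sets borel. emeasure \<nu> ((\<lambda>u. u + \<tau>) -` B) = emeasure \<nu> B)"
proof -
  have "0 < \<epsilon> / 2" using \<epsilon> by simp
  then obtain x where x: "x \<in> spt \<mu>" "x \<noteq> p" "dist p x < \<epsilon> / 2"
    using spt_no_isolated_points[OF p_in_spt] by blast
  obtain t where t: "x = param t" using in_line[OF x(1)] unfolding param_def by blast
  have p: "p = param 0" by (simp add: param_def)
  have "t \<noteq> 0" using x(2) t p by auto
  have "\<bar>t\<bar> < \<epsilon> / 2" using x(3) dist_param[of 0 t] by (simp add: t flip: p)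
  have T: "param 0 \<in> spt \<mu>" "param t \<in> spt \<mu>" using x t p p_in_spt by auto
  show ?thesis
  proof (intro exI[of _ "2 * \<bar>t\<bar>"] conjI ballI)
    fix B :: "real set" assume B: "B \<in> sets borel"
    show "emeasure \<nu> ((\<lambda>u. u + 2 * \<bar>t\<bar>) -` B) = emeasure \<nu> B"
    proof (cases "0 \<le> t")
      case True
      then show ?thesis using translation[OF T B] by simp
    next
      case False
      then show ?thesis using translation[OF T(2) T(1) B] by simp
    qed
  qed (use \<open>t \<noteq> 0\<close> \<open>\<bar>t\<bar> < \<epsilon> / 2\<close> in auto)
qed

theorem is_hausdorff_on_line:
  "\<exists>(c::real) (L :: complex set). c > 0 \<and> affine L \<and> aff_dim L = 1 \<and>
      (\<forall>A\<in>sets borel. emeasure \<mu> A = ennreal c * hausdorff1 (A \<inter> L))"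
proof -
  have fin: "emeasure \<nu> {a..b} < \<infinity>" for a b
  proof -
    define R where "R = \<bar>a\<bar> + \<bar>b\<bar> + 1"
    have "dist p (param t) < R" if "t \<in> {a..b}" for t
      using dist_param[of 0 t] that by (auto simp: R_def param_def)
    then have "{a..b} \<subseteq> param -` ball p R" by auto
    then have "emeasure \<nu> {a..b} \<le> emeasure \<nu> (param -` ball p R)"
      using measurable_sets[OF param_measurable, of "ball p R"] by (intro emeasure_mono) (auto simp: sets_\<nu>)
    also have "\<dots> = emeasure \<mu> (ball p R)" by (simp add: emeasure_line)
    also have "\<dots> < \<infinity>" by (rule ball_finite)
    finally show ?thesis .
  qed
  have "emeasure \<nu> UNIV \<noteq> 0" using nonzero emeasure_line[of UNIV] by simp
  from small_periods_imp_lborel_multiple[OF sets_\<nu> fin this small_periods]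
  obtain c where c: "c > 0" "\<And>B. B \<in> sets borel \<Longrightarrow> emeasure \<nu> B = ennreal c * emeasure lborel B"
    by blast
  define L where "L = range param"
  have L: "L = affine hull {p, p + e}"
    unfolding L_def affine_hull_2_alt param_def by (simp add: scaleR_conv_of_real)
  have "e \<noteq> 0" using unit by auto
  then have "aff_dim L = 1" unfolding L aff_dim_affine_hull by (simp add: aff_dim_2)
  moreover have "affine L" unfolding L by (rule affine_affine_hull)
  moreover have "emeasure \<mu> A = ennreal c * hausdorff1 (A \<inter> L)" if A: "A \<in> sets borel" for A
  proof -
    have A': "param -` A \<in> sets borel" using measurable_sets[OF param_measurable A] by simp
    have "A \<inter> L = param ` (param -` A)" by (auto simp: L_def)
    then show ?thesis
      using hausdorff1_isometric_image[OF dist_param A'] emeasure_line[OF A] c(2)[OF A'] by simp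
  qed
  ultimately show ?thesis using c(1) by blast
qed

end


theorem theorem1p4:
  shows "\<exists>\<delta>\<^sub>0::real. \<delta>\<^sub>0 > 0 \<and> 1/20 \<le> \<delta>\<^sub>0 \<and>
    (\<forall>(\<Omega> :: complex \<Rightarrow> complex) (\<delta> :: real) (\<mu> :: complex measure).
        \<Omega> \<in> unit_circle \<rightarrow> unit_circle \<longrightarrow>
        odd_on_circle \<Omega> \<longrightarrow>
        C2_on_circle \<Omega> \<longrightarrow>
        0 \<le> \<delta> \<longrightarrow> \<delta> \<le> \<delta>\<^sub>0 \<longrightarrow>
        bilipschitz_on_circle (1 + \<delta>) \<Omega> \<longrightarrow>
        locally_finite_borel \<mu> \<longrightarrow>
        emeasure \<mu> (space \<mu>) \<noteq> 0 \<longrightarrow>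
        ahlfors_1_regular \<mu> \<longrightarrow>
        symmetric_measure \<Omega> \<mu> \<longrightarrow>
        (\<exists>(c::real) (L :: complex set). c > 0 \<and> affine L \<and> aff_dim L = 1 \<and>
            (\<forall>A\<in>sets borel. emeasure \<mu> A = ennreal c * hausdorff1 (A \<inter> L))))"
proof (rule exI[of _ "1/20 :: real"], intro conjI allI impI)
  fix \<Omega> :: "complex \<Rightarrow> complex" and \<delta> :: real and \<mu> :: "complex measure"
  assume map: "\<Omega> \<in> unit_circle \<rightarrow> unit_circle" and odd: "odd_on_circle \<Omega>"
    and C2: "C2_on_circle \<Omega>" and \<delta>: "0 \<le> \<delta>"
    and bilip: "bilipschitz_on_circle (1 + \<delta>) \<Omega>"
    and borel: "locally_finite_borel \<mu>" and nz: "emeasure \<mu> (space \<mu>) \<noteq> 0"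
    and reg: "ahlfors_1_regular \<mu>" and sym: "symmetric_measure \<Omega> \<mu>"
  define \<kappa> where "\<kappa> = inverse (1 + \<delta>)"
  have \<kappa>: "0 < \<kappa>" using \<delta> by (simp add: \<kappa>_def)
  have cont: "continuous_on UNIV (\<lambda>s. \<Omega> (cis s))"
    using C2 unfolding C2_on_circle_def
    by (meson continuous_at_imp_continuous_on has_vector_derivative_continuous)
  have expand: "\<kappa> * circle_dist u v \<le> circle_dist (\<Omega> u) (\<Omega> v)"
    if "u \<in> unit_circle" "v \<in> unit_circle" for u v
    using bilip that unfolding bilipschitz_on_circle_def \<kappa>_def by blast
  obtain \<omega> where \<omega>: "angle_lift \<Omega> \<omega> \<kappa>"
    using circle_angle_lift[OF map odd cont \<kappa> expand] map odd \<kappa> unfolding angle_lift_def by metis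
  obtain C where C: "0 < C" "ahlfors_1_regular_with C \<mu>" using reg unfolding ahlfors_1_regular_def by blast
  interpret angle_lift \<Omega> \<omega> \<kappa> by (rule \<omega>)
  interpret symmetric_regular \<Omega> \<omega> \<kappa> \<mu> C
    using cont borel nz C sym by unfold_locales (auto simp: locally_finite_borel_def)
  obtain p e where "p \<in> spt \<mu>" "cmod e = 1" "\<And>x. x \<in> spt \<mu> \<Longrightarrow> \<exists>t::real. x = p + of_real t * e"
    using spt_in_line by blast
  then interpret symmetric_regular_line \<Omega> \<omega> \<kappa> \<mu> C p e by unfold_locales
  show "\<exists>(c::real) (L :: complex set). c > 0 \<and> affine L \<and> aff_dim L = 1 \<and>
      (\<forall>A\<in>sets borel. emeasure \<mu> A = ennreal c * hausdorff1 (A \<inter> L))"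
    by (rule is_hausdorff_on_line)
qed simp_all

end
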